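(* Let $\mathbb{K}$ be a field of characteristic $0$, let $X=\{x_i\}$ be a set of generators with linearly ordered indices, and let $\mathrm{di}\text{-}\mathrm{Lie}^{\mathrm I}\langle X\rangle$ be the free initial Lie dialgebra on $X$ over $\mathbb{K}$. Put $[a,b]=ab-ba$ and $\{a,b\}=ab+ba$ in this algebra. Let $$\mathcal{C}^S_n=\bigl\{\,\{\{\cdots\{\{x_{i_1},x_{i_2}\},x_{i_3}\},\cdots\},x_{i_n}\}\ :\ i_1\le i_2,\ i_3\le\cdots\le i_n\,\bigr\},$$ and set $$\mathcal{L}^{I}=\bigcup_{n\ge1}\mathcal{C}^S_n\ \cup\ \mathcal{L},$$ where $\mathcal{L}$ is a basis of the free Lie algebra $\mathrm{Lie}\langle X\rangle$. Then the set $\mathcal{L}^{I}$ is a basis of the free initial Lie dialgebra $\mathrm{di}\text{-}\mathrm{Lie}^{\mathrm I}\langle X\rangle$. In particular, $$\mathrm{di}\text{-}\mathrm{Lie}^{\mathrm I}\langle X\rangle=\mathrm{Lie}\langle X\rangle\oplus \mathrm{Com}^S\langle X\rangle$$ as a vector space, where $\mathrm{Com}^S\langle X\rangle$ is the free commutative algebra on $X$ with the identities $\{\{\{a,b\},d\},c\}=\{\{\{a,b\},c\},d\}$ and $\{\{a,b\},\{c,d\}\}=0$.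
   Context: An initial Lie dialgebra is a $\mathbb{K}$-vector space with one bilinear operation $(a,b)\mapsto ab$ (playing the role of $a\vdash b$) satisfying the Leibniz identity $$(ab)c=a(bc)-b(ac)$$ and the additional identity $$a(bc)-a(cb)-b(ac)+b(ca)+c(ab)-c(ba)=0 .$$ $\mathrm{di}\text{-}\mathrm{Lie}^{\mathrm I}$ denotes the variety of initial Lie dialgebras and $\mathrm{di}\text{-}\mathrm{Lie}^{\mathrm I}\langle X\rangle$ its free algebra on $X$. Elements of $\mathcal{L}$ are regarded as elements of $\mathrm{di}\text{-}\mathrm{Lie}^{\mathrm I}\langle X\rangle$ by reading the Lie bracket as the commutator $[\cdot,\cdot]$. In $\mathrm{Com}^S\langle X\rangle$ the commutative (not necessarily associative) product is written $\{\cdot,\cdot\}$.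
   Formalization: The basis L is required to contain X (else L={2x} makes the set dependent); for arbitrary L the union starts at n=2. The direct sum is proved as an abstract linear isomorphism and, canonically, with Com^S⟨X⟩ replaced by its part of degree at least 2, as generators lie in both summands. *)

theory Defs
  imports Complex_Main "HOL-Library.Poly_Mapping" "HOL-Library.Product_Plus"
begin

section \<open>Nonassociative algebras and the three varieties\<close>

locale nonassoc_algebra = vector_space scale
  for scale :: "'k::field \<Rightarrow> 'a::ab_group_add \<Rightarrow> 'a" +
  fixes mult :: "'a \<Rightarrow> 'a \<Rightarrow> 'a"
  assumes mult_add_left: "mult (a + b) c = mult a c + mult b c"
    and mult_add_right: "mult a (b + c) = mult a b + mult a c"
    and mult_scale_left: "mult (scale r a) b = scale r (mult a b)"
    and mult_scale_right: "mult a (scale r b) = scale r (mult a b)"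
begin

lemma mult_zero_left [simp]: "mult 0 a = 0"
  by (metis add_cancel_right_right mult_add_left)

lemma mult_zero_right [simp]: "mult a 0 = 0"
  by (metis add_cancel_right_right mult_add_right)

lemma mult_minus_left: "mult (- a) b = - mult a b"
  by (rule minus_unique[symmetric]) (simp flip: mult_add_left)

lemma mult_minus_right: "mult a (- b) = - mult a b"
  by (rule minus_unique[symmetric]) (simp flip: mult_add_right)

lemma mult_diff_left: "mult (a - b) c = mult a c - mult b c"
  using mult_add_left[of a "- b" c] by (simp add: mult_minus_left)

lemma mult_diff_right: "mult a (b - c) = mult a b - mult a c"
  using mult_add_right[of a b "- c"] by (simp add: mult_minus_right)

lemma mult_sum_left: "mult (sum f A) b = (\<Sum>i\<in>A. mult (f i) b)"
  by (induction A rule: infinite_finite_induct) (simp_all add: mult_add_left)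

lemma mult_sum_right: "mult b (sum f A) = (\<Sum>i\<in>A. mult b (f i))"
  by (induction A rule: infinite_finite_induct) (simp_all add: mult_add_right)

lemmas mult_simps = mult_add_left mult_add_right mult_diff_left mult_diff_right
  mult_minus_left mult_minus_right mult_scale_left mult_scale_right

end

locale initial_lie_dialgebra = nonassoc_algebra +
  assumes leibniz: "mult (mult a b) c = mult a (mult b c) - mult b (mult a c)"
    and initial: "mult a (mult b c) - mult a (mult c b) - mult b (mult a c)
      + mult b (mult c a) + mult c (mult a b) - mult c (mult b a) = 0"

locale lie_alg = nonassoc_algebra +
  assumes alternating: "mult a a = 0"
    and jacobi: "mult a (mult b c) + mult b (mult c a) + mult c (mult a b) = 0"

locale com_s_algebra = nonassoc_algebra +
  assumes commute: "mult a b = mult b a"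
    and swap: "mult (mult (mult a b) d) c = mult (mult (mult a b) c) d"
    and metabelian: "mult (mult a b) (mult c d) = 0"


section \<open>The free nonassociative algebra\<close>

datatype 'x word = Gen 'x | Node "'x word" "'x word"

type_synonym ('x, 'k) free_nonassoc = "'x word \<Rightarrow>\<^sub>0 'k"

definition na_scale :: "'k::field \<Rightarrow> ('x, 'k) free_nonassoc \<Rightarrow> ('x, 'k) free_nonassoc" where
  "na_scale c p = Poly_Mapping.map ((*) c) p"

definition na_mult :: "('x, 'k::field) free_nonassoc \<Rightarrow> ('x, 'k) free_nonassoc \<Rightarrow> ('x, 'k) free_nonassoc"
  (infixl "\<odot>" 70) where
  "p \<odot> q = (\<Sum>u\<in>Poly_Mapping.keys p. \<Sum>v\<in>Poly_Mapping.keys q.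
     Poly_Mapping.single (Node u v) (Poly_Mapping.lookup p u * Poly_Mapping.lookup q v))"

definition na_gen :: "'x \<Rightarrow> ('x, 'k::field) free_nonassoc" where
  "na_gen x = Poly_Mapping.single (Gen x) 1"

lemma lookup_na_scale [simp]:
  "Poly_Mapping.lookup (na_scale c p) w = c * Poly_Mapping.lookup p w"
  by (simp add: na_scale_def Poly_Mapping.map.rep_eq when_def)

lemma vector_space_na: "vector_space na_scale"
  by standard (auto intro!: poly_mapping_eqI simp: lookup_add algebra_simps)

lemma na_mult_superset:
  assumes "finite A" "Poly_Mapping.keys p \<subseteq> A" "finite B" "Poly_Mapping.keys q \<subseteq> B"
  shows "p \<odot> q = (\<Sum>u\<in>A. \<Sum>v\<in>B.
     Poly_Mapping.single (Node u v) (Poly_Mapping.lookup p u * Poly_Mapping.lookup q v))"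
proof -
  have "p \<odot> q = (\<Sum>u\<in>Poly_Mapping.keys p. \<Sum>v\<in>B.
     Poly_Mapping.single (Node u v) (Poly_Mapping.lookup p u * Poly_Mapping.lookup q v))"
    unfolding na_mult_def using assms
    by (intro sum.cong refl sum.mono_neutral_left) (auto simp: in_keys_iff)
  also have "\<dots> = (\<Sum>u\<in>A. \<Sum>v\<in>B.
     Poly_Mapping.single (Node u v) (Poly_Mapping.lookup p u * Poly_Mapping.lookup q v))"
    using assms by (intro sum.mono_neutral_left) (auto simp: in_keys_iff)
  finally show ?thesis .
qed

lemma na_scale_single: "na_scale c (Poly_Mapping.single w a) = Poly_Mapping.single w (c * a)"
  by (rule poly_mapping_eqI) (simp add: lookup_single when_def)

lemma nonassoc_algebra_na:
  "nonassoc_algebra (na_scale :: 'k::field \<Rightarrow> ('x, 'k) free_nonassoc \<Rightarrow> _) (\<odot>)"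
proof -
  interpret vector_space "na_scale :: 'k \<Rightarrow> ('x, 'k) free_nonassoc \<Rightarrow> _"
    by (rule vector_space_na)
  show ?thesis
  proof
    fix a b c :: "('x, 'k) free_nonassoc" and r :: 'k
    let ?A = "Poly_Mapping.keys a \<union> Poly_Mapping.keys b \<union> Poly_Mapping.keys c
      \<union> Poly_Mapping.keys (a + b) \<union> Poly_Mapping.keys (b + c)
      \<union> Poly_Mapping.keys (na_scale r a) \<union> Poly_Mapping.keys (na_scale r b)"
    have A: "finite ?A" by simp
    have e: "p \<odot> q = (\<Sum>u\<in>?A. \<Sum>v\<in>?A. Poly_Mapping.single (Node u v)
        (Poly_Mapping.lookup p u * Poly_Mapping.lookup q v))"
      if "Poly_Mapping.keys p \<subseteq> ?A" "Poly_Mapping.keys q \<subseteq> ?A" for p q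
      by (rule na_mult_superset[OF A that(1) A that(2)])
    have k: "Poly_Mapping.keys a \<subseteq> ?A" "Poly_Mapping.keys b \<subseteq> ?A" "Poly_Mapping.keys c \<subseteq> ?A"
      "Poly_Mapping.keys (a + b) \<subseteq> ?A" "Poly_Mapping.keys (b + c) \<subseteq> ?A"
      "Poly_Mapping.keys (na_scale r a) \<subseteq> ?A" "Poly_Mapping.keys (na_scale r b) \<subseteq> ?A"
      by blast+
    show "(a + b) \<odot> c = a \<odot> c + b \<odot> c"
      unfolding e[OF k(4) k(3)] e[OF k(1) k(3)] e[OF k(2) k(3)]
      by (simp add: lookup_add distrib_right single_add sum.distrib)
    show "a \<odot> (b + c) = a \<odot> b + a \<odot> c"
      unfolding e[OF k(1) k(5)] e[OF k(1) k(2)] e[OF k(1) k(3)]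
      by (simp add: lookup_add distrib_left single_add sum.distrib)
    show "na_scale r a \<odot> b = na_scale r (a \<odot> b)"
      unfolding e[OF k(6) k(2)] e[OF k(1) k(2)]
      by (simp add: scale_sum_right na_scale_single mult.assoc)
    show "a \<odot> na_scale r b = na_scale r (a \<odot> b)"
      unfolding e[OF k(1) k(7)] e[OF k(1) k(2)]
      by (simp add: scale_sum_right na_scale_single mult.left_commute)
  qed
qed

global_interpretation na: nonassoc_algebra na_scale na_mult
  by (rule nonassoc_algebra_na)

inductive_set ideal_hull ::
  "('x, 'k::field) free_nonassoc set \<Rightarrow> ('x, 'k) free_nonassoc set"
  for S :: "('x, 'k) free_nonassoc set" where
  base: "p \<in> S \<Longrightarrow> p \<in> ideal_hull S"
| zero: "0 \<in> ideal_hull S"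
| add: "p \<in> ideal_hull S \<Longrightarrow> q \<in> ideal_hull S \<Longrightarrow> p + q \<in> ideal_hull S"
| scale: "p \<in> ideal_hull S \<Longrightarrow> na_scale c p \<in> ideal_hull S"
| mult_left: "p \<in> ideal_hull S \<Longrightarrow> q \<odot> p \<in> ideal_hull S"
| mult_right: "p \<in> ideal_hull S \<Longrightarrow> p \<odot> q \<in> ideal_hull S"

lemma ideal_hull_minus: "p \<in> ideal_hull S \<Longrightarrow> - p \<in> ideal_hull S"
  using ideal_hull.scale[of p S "- 1"] by simp

lemma ideal_hull_diff: "p \<in> ideal_hull S \<Longrightarrow> q \<in> ideal_hull S \<Longrightarrow> p - q \<in> ideal_hull S"
  using ideal_hull.add[of p S "- q"] by (simp add: ideal_hull_minus)

definition cong_mod :: "('x, 'k::field) free_nonassoc set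
    \<Rightarrow> ('x, 'k) free_nonassoc \<Rightarrow> ('x, 'k) free_nonassoc \<Rightarrow> bool" where
  "cong_mod S p q \<longleftrightarrow> p - q \<in> ideal_hull S"

lemma equivp_cong_mod: "equivp (cong_mod S)"
proof (rule equivpI)
  show "reflp (cong_mod S)" by (auto simp: reflp_def cong_mod_def ideal_hull.zero)
  show "symp (cong_mod S)"
    using ideal_hull_minus[of "_ - _" S] by (fastforce simp: symp_def cong_mod_def)
  show "transp (cong_mod S)"
    using ideal_hull.add[of "_ - _" S "_ - _"] by (fastforce simp: transp_def cong_mod_def)
qed

lemma cong_mod_refl: "p = q \<Longrightarrow> cong_mod S p q"
  by (simp add: cong_mod_def ideal_hull.zero)

lemma cong_mod_base: "p - q \<in> S \<Longrightarrow> cong_mod S p q"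
  by (simp add: cong_mod_def ideal_hull.base)

lemma cong_mod_add: "cong_mod S p p' \<Longrightarrow> cong_mod S q q' \<Longrightarrow> cong_mod S (p + q) (p' + q')"
  unfolding cong_mod_def using ideal_hull.add[of "p - p'" S "q - q'"] by (simp add: add_diff_add)

lemma cong_mod_diff:
  assumes "cong_mod S p p'" "cong_mod S q q'"
  shows "cong_mod S (p - q) (p' - q')"
proof -
  have "(p - q) - (p' - q') = (p - p') - (q - q')"
    by simp
  then show ?thesis
    using ideal_hull_diff[of "p - p'" S "q - q'"] assms by (simp only: cong_mod_def)
qed

lemma cong_mod_minus: "cong_mod S p p' \<Longrightarrow> cong_mod S (- p) (- p')"
  unfolding cong_mod_def using ideal_hull_minus[of "p - p'" S] by simp

lemma cong_mod_scale: "cong_mod S p p' \<Longrightarrow> cong_mod S (na_scale c p) (na_scale c p')"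
  unfolding cong_mod_def using ideal_hull.scale[of "p - p'" S c]
  by (simp add: na.scale_right_diff_distrib)

lemma cong_mod_mult: "cong_mod S p p' \<Longrightarrow> cong_mod S q q' \<Longrightarrow> cong_mod S (p \<odot> q) (p' \<odot> q')"
  unfolding cong_mod_def
  using ideal_hull.add[OF ideal_hull.mult_right[of "p - p'" S q] ideal_hull.mult_left[of "q - q'" S p']]
  by (simp add: na.mult_diff_left na.mult_diff_right)

text \<open>The extension of a map \<open>f\<close> on generators to an algebra homomorphism from the free
  nonassociative algebra.\<close>

primrec word_eval :: "('a \<Rightarrow> 'a \<Rightarrow> 'a) \<Rightarrow> ('x \<Rightarrow> 'a) \<Rightarrow> 'x word \<Rightarrow> 'a" where
  "word_eval mult f (Gen x) = f x"
| "word_eval mult f (Node u v) = mult (word_eval mult f u) (word_eval mult f v)"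

definition na_extend :: "('k::field \<Rightarrow> 'a \<Rightarrow> 'a) \<Rightarrow> ('a \<Rightarrow> 'a \<Rightarrow> 'a) \<Rightarrow> ('x \<Rightarrow> 'a)
    \<Rightarrow> ('x, 'k) free_nonassoc \<Rightarrow> 'a::ab_group_add" where
  "na_extend scale mult f p =
     (\<Sum>w\<in>Poly_Mapping.keys p. scale (Poly_Mapping.lookup p w) (word_eval mult f w))"

context nonassoc_algebra
begin

abbreviation ext :: "('x \<Rightarrow> 'a) \<Rightarrow> ('x, 'k) free_nonassoc \<Rightarrow> 'a" where
  "ext \<equiv> na_extend scale mult"

lemma ext_superset:
  assumes "finite A" "Poly_Mapping.keys p \<subseteq> A"
  shows "ext f p = (\<Sum>w\<in>A. scale (Poly_Mapping.lookup p w) (word_eval mult f w))"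
  unfolding na_extend_def using assms
  by (intro sum.mono_neutral_left) (auto simp: in_keys_iff)

lemma ext_zero [simp]: "ext f 0 = 0"
  by (simp add: na_extend_def)

lemma ext_add: "ext f (p + q) = ext f p + ext f q"
proof -
  let ?A = "Poly_Mapping.keys p \<union> Poly_Mapping.keys q \<union> Poly_Mapping.keys (p + q)"
  have A: "finite ?A" by simp
  have "Poly_Mapping.keys p \<subseteq> ?A" "Poly_Mapping.keys q \<subseteq> ?A" "Poly_Mapping.keys (p + q) \<subseteq> ?A"
    by blast+
  then show ?thesis
    by (simp only: ext_superset[OF A] lookup_add scale_left_distrib sum.distrib)
qed

lemma ext_scale: "ext f (na_scale c p) = scale c (ext f p)"
proof -
  let ?A = "Poly_Mapping.keys p \<union> Poly_Mapping.keys (na_scale c p)"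
  have A: "finite ?A" by simp
  have "Poly_Mapping.keys p \<subseteq> ?A" "Poly_Mapping.keys (na_scale c p) \<subseteq> ?A"
    by blast+
  then show ?thesis
    by (simp only: ext_superset[OF A] lookup_na_scale scale_sum_right scale_scale)
qed

lemma ext_minus: "ext f (- p) = - ext f p"
  by (rule minus_unique[symmetric]) (simp flip: ext_add)

lemma ext_diff: "ext f (p - q) = ext f p - ext f q"
  using ext_add[of f p "- q"] by (simp add: ext_minus)

lemma ext_sum: "ext f (sum g A) = (\<Sum>i\<in>A. ext f (g i))"
  by (induction A rule: infinite_finite_induct) (simp_all add: ext_add)

lemma ext_single: "ext f (Poly_Mapping.single w c) = scale c (word_eval mult f w)"
  by (cases "c = 0") (simp_all add: na_extend_def)

lemma ext_gen [simp]: "ext f (na_gen x) = f x"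
  by (simp add: na_gen_def ext_single)

lemma ext_mult: "ext f (p \<odot> q) = mult (ext f p) (ext f q)"
proof -
  have "ext f (p \<odot> q) = (\<Sum>u\<in>Poly_Mapping.keys p. \<Sum>v\<in>Poly_Mapping.keys q.
      scale (Poly_Mapping.lookup p u * Poly_Mapping.lookup q v)
        (mult (word_eval mult f u) (word_eval mult f v)))"
    by (simp add: na_mult_def ext_sum ext_single)
  also have "\<dots> = mult (ext f p) (ext f q)"
    unfolding na_extend_def mult_sum_left
    unfolding mult_sum_right mult_scale_left mult_scale_right scale_scale
    by (intro sum.cong refl arg_cong2[where f = scale] mult.commute)
  finally show ?thesis .
qed

lemmas ext_simps = ext_add ext_diff ext_minus ext_scale ext_mult

lemma ext_ideal_hull:
  assumes "p \<in> ideal_hull S" "\<And>s. s \<in> S \<Longrightarrow> ext f s = 0"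
  shows "ext f p = 0"
  using assms(1) by induction (simp_all add: assms(2) ext_simps)

lemma ext_cong:
  assumes "cong_mod S p q" "\<And>s. s \<in> S \<Longrightarrow> ext f s = 0"
  shows "ext f p = ext f q"
  using ext_ideal_hull[of "p - q" S f] assms by (simp add: cong_mod_def ext_diff)

end


section \<open>The free algebras of the three varieties\<close>

text \<open>In each case the ideal is generated by the values of the defining identities at
  \<^emph>\<open>all\<close> elements of the free nonassociative algebra, so that the quotient is the
  free algebra of the variety.\<close>

definition dilie_ids :: "('x, 'k::field) free_nonassoc set" where
  "dilie_ids =
     {(a \<odot> b) \<odot> c - (a \<odot> (b \<odot> c) - b \<odot> (a \<odot> c)) | a b c. True} \<union>
     {a \<odot> (b \<odot> c) - a \<odot> (c \<odot> b) - b \<odot> (a \<odot> c)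
        + b \<odot> (c \<odot> a) + c \<odot> (a \<odot> b) - c \<odot> (b \<odot> a) | a b c. True}"

definition lie_ids :: "('x, 'k::field) free_nonassoc set" where
  "lie_ids =
     {a \<odot> a | a. True} \<union>
     {a \<odot> (b \<odot> c) + b \<odot> (c \<odot> a) + c \<odot> (a \<odot> b) | a b c. True}"

definition com_s_ids :: "('x, 'k::field) free_nonassoc set" where
  "com_s_ids =
     {a \<odot> b - b \<odot> a | a b. True} \<union>
     {((a \<odot> b) \<odot> d) \<odot> c - ((a \<odot> b) \<odot> c) \<odot> d | a b c d. True} \<union>
     {(a \<odot> b) \<odot> (c \<odot> d) | a b c d. True}"

quotient_type (overloaded) ('x, 'k) free_dilie = "('x, 'k::field) free_nonassoc" / "cong_mod dilie_ids"
  by (rule equivp_cong_mod)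

instantiation free_dilie :: (type, field) ab_group_add
begin
lift_definition zero_free_dilie :: "('a, 'b) free_dilie" is 0 .
lift_definition plus_free_dilie :: "('a, 'b) free_dilie \<Rightarrow> ('a, 'b) free_dilie \<Rightarrow> ('a, 'b) free_dilie" is "(+)"
  by (rule cong_mod_add)
lift_definition minus_free_dilie :: "('a, 'b) free_dilie \<Rightarrow> ('a, 'b) free_dilie \<Rightarrow> ('a, 'b) free_dilie" is "(-)"
  by (rule cong_mod_diff)
lift_definition uminus_free_dilie :: "('a, 'b) free_dilie \<Rightarrow> ('a, 'b) free_dilie" is uminus
  by (rule cong_mod_minus)
instance
  by (standard; transfer; rule cong_mod_refl) (simp_all add: ac_simps)
end

lift_definition dilie_scale :: "'k::field \<Rightarrow> ('x, 'k) free_dilie \<Rightarrow> ('x, 'k) free_dilie" is na_scale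
  by (rule cong_mod_scale)

lift_definition dilie_mult :: "('x, 'k::field) free_dilie \<Rightarrow> ('x, 'k) free_dilie \<Rightarrow> ('x, 'k) free_dilie" is na_mult
  by (rule cong_mod_mult)

lift_definition dilie_gen :: "'x \<Rightarrow> ('x, 'k::field) free_dilie" is na_gen .

global_interpretation dilie: initial_lie_dialgebra dilie_scale dilie_mult
proof -
  interpret nonassoc_algebra dilie_scale dilie_mult
    by (standard; transfer; rule cong_mod_refl)
       (simp_all add: na.mult_simps na.scale_right_distrib na.scale_left_distrib)
  show "initial_lie_dialgebra dilie_scale dilie_mult"
    by (standard; transfer; rule cong_mod_base) (simp_all add: dilie_ids_def, blast+)
qed

quotient_type (overloaded) ('x, 'k) free_lie = "('x, 'k::field) free_nonassoc" / "cong_mod lie_ids"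
  by (rule equivp_cong_mod)

instantiation free_lie :: (type, field) ab_group_add
begin
lift_definition zero_free_lie :: "('a, 'b) free_lie" is 0 .
lift_definition plus_free_lie :: "('a, 'b) free_lie \<Rightarrow> ('a, 'b) free_lie \<Rightarrow> ('a, 'b) free_lie" is "(+)"
  by (rule cong_mod_add)
lift_definition minus_free_lie :: "('a, 'b) free_lie \<Rightarrow> ('a, 'b) free_lie \<Rightarrow> ('a, 'b) free_lie" is "(-)"
  by (rule cong_mod_diff)
lift_definition uminus_free_lie :: "('a, 'b) free_lie \<Rightarrow> ('a, 'b) free_lie" is uminus
  by (rule cong_mod_minus)
instance
  by (standard; transfer; rule cong_mod_refl) (simp_all add: ac_simps)
end

lift_definition lie_scale :: "'k::field \<Rightarrow> ('x, 'k) free_lie \<Rightarrow> ('x, 'k) free_lie" is na_scale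
  by (rule cong_mod_scale)

lift_definition lie_mult :: "('x, 'k::field) free_lie \<Rightarrow> ('x, 'k) free_lie \<Rightarrow> ('x, 'k) free_lie" is na_mult
  by (rule cong_mod_mult)

lift_definition lie_gen :: "'x \<Rightarrow> ('x, 'k::field) free_lie" is na_gen .

global_interpretation lie: lie_alg lie_scale lie_mult
proof -
  interpret nonassoc_algebra lie_scale lie_mult
    by (standard; transfer; rule cong_mod_refl)
       (simp_all add: na.mult_simps na.scale_right_distrib na.scale_left_distrib)
  show "lie_alg lie_scale lie_mult"
    by (standard; transfer; rule cong_mod_base) (simp_all add: lie_ids_def, blast+)
qed

quotient_type (overloaded) ('x, 'k) free_com_s = "('x, 'k::field) free_nonassoc" / "cong_mod com_s_ids"
  by (rule equivp_cong_mod)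

instantiation free_com_s :: (type, field) ab_group_add
begin
lift_definition zero_free_com_s :: "('a, 'b) free_com_s" is 0 .
lift_definition plus_free_com_s :: "('a, 'b) free_com_s \<Rightarrow> ('a, 'b) free_com_s \<Rightarrow> ('a, 'b) free_com_s" is "(+)"
  by (rule cong_mod_add)
lift_definition minus_free_com_s :: "('a, 'b) free_com_s \<Rightarrow> ('a, 'b) free_com_s \<Rightarrow> ('a, 'b) free_com_s" is "(-)"
  by (rule cong_mod_diff)
lift_definition uminus_free_com_s :: "('a, 'b) free_com_s \<Rightarrow> ('a, 'b) free_com_s" is uminus
  by (rule cong_mod_minus)
instance
  by (standard; transfer; rule cong_mod_refl) (simp_all add: ac_simps)
end

lift_definition com_s_scale :: "'k::field \<Rightarrow> ('x, 'k) free_com_s \<Rightarrow> ('x, 'k) free_com_s" is na_scale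
  by (rule cong_mod_scale)

lift_definition com_s_mult :: "('x, 'k::field) free_com_s \<Rightarrow> ('x, 'k) free_com_s \<Rightarrow> ('x, 'k) free_com_s" is na_mult
  by (rule cong_mod_mult)

lift_definition com_s_gen :: "'x \<Rightarrow> ('x, 'k::field) free_com_s" is na_gen .

global_interpretation com_s: com_s_algebra com_s_scale com_s_mult
proof -
  interpret nonassoc_algebra com_s_scale com_s_mult
    by (standard; transfer; rule cong_mod_refl)
       (simp_all add: na.mult_simps na.scale_right_distrib na.scale_left_distrib)
  show "com_s_algebra com_s_scale com_s_mult"
    by (standard; transfer; rule cong_mod_base) (simp_all add: com_s_ids_def, blast+)
qed


section \<open>Commutator and anticommutator\<close>

definition commutator :: "('a \<Rightarrow> 'a \<Rightarrow> 'a::ab_group_add) \<Rightarrow> 'a \<Rightarrow> 'a \<Rightarrow> 'a" where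
  "commutator mult a b = mult a b - mult b a"

definition anticommutator :: "('a \<Rightarrow> 'a \<Rightarrow> 'a::ab_group_add) \<Rightarrow> 'a \<Rightarrow> 'a \<Rightarrow> 'a" where
  "anticommutator mult a b = mult a b + mult b a"

context initial_lie_dialgebra
begin

abbreviation (input) "comm \<equiv> commutator mult"
abbreviation (input) "acomm \<equiv> anticommutator mult"

lemma mult_swap_left: "mult (mult b a) c = - mult (mult a b) c"
  by (simp add: leibniz)

lemma mult_acomm_left: "mult (acomm a b) c = 0"
  by (simp add: anticommutator_def mult_add_left mult_swap_left[of b a])

lemma acomm_acomm_left: "acomm (acomm a b) c = mult c (acomm a b)"
  by (simp add: anticommutator_def[of mult "acomm a b"] mult_acomm_left)

lemma mult_mult_acomm: "mult a (mult b (acomm c d)) = mult b (mult a (acomm c d))"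
  using initial[of a b "acomm c d"] by (simp add: mult_acomm_left)

lemma lie_alg_comm: "lie_alg scale (commutator mult)"
proof
  show "comm (a + b) c = comm a c + comm b c" for a b c
    by (simp add: commutator_def mult_simps)
  show "comm a (b + c) = comm a b + comm a c" for a b c
    by (simp add: commutator_def mult_simps)
  show "comm (scale r a) b = scale r (comm a b)" for r a b
    by (simp add: commutator_def mult_simps scale_right_diff_distrib)
  show "comm a (scale r b) = scale r (comm a b)" for r a b
    by (simp add: commutator_def mult_simps scale_right_diff_distrib)
  show "comm a a = 0" for a
    by (simp add: commutator_def)
  show "comm a (comm b c) + comm b (comm c a) + comm c (comm a b) = 0" for a b c
  proof -
    let ?J = "mult a (mult b c) - mult a (mult c b) - mult b (mult a c)
      + mult b (mult c a) + mult c (mult a b) - mult c (mult b a)"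
    have "comm a (comm b c) + comm b (comm c a) + comm c (comm a b) = ?J - (?J + ?J)"
      by (simp add: commutator_def mult_simps leibniz)
    then show ?thesis by (simp add: initial)
  qed
qed

lemma com_s_algebra_acomm: "com_s_algebra scale (anticommutator mult)"
proof
  show "acomm (a + b) c = acomm a c + acomm b c" for a b c
    by (simp add: anticommutator_def mult_simps)
  show "acomm a (b + c) = acomm a b + acomm a c" for a b c
    by (simp add: anticommutator_def mult_simps)
  show "acomm (scale r a) b = scale r (acomm a b)" for r a b
    by (simp add: anticommutator_def mult_simps scale_right_distrib)
  show "acomm a (scale r b) = scale r (acomm a b)" for r a b
    by (simp add: anticommutator_def mult_simps scale_right_distrib)
  show "acomm a b = acomm b a" for a b
    by (simp add: anticommutator_def add.commute)
  show "acomm (acomm (acomm a b) d) c = acomm (acomm (acomm a b) c) d" for a b c d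
    by (simp add: acomm_acomm_left anticommutator_def[of mult "mult _ (acomm _ _)"] leibniz
        mult_acomm_left mult_mult_acomm[of c d])
  show "acomm (acomm a b) (acomm c d) = 0" for a b c d
    by (simp add: acomm_acomm_left mult_acomm_left)
qed

end


section \<open>The maps into the free initial Lie dialgebra\<close>

abbreviation dilie_comm ::
    "('x, 'k::field) free_dilie \<Rightarrow> ('x, 'k) free_dilie \<Rightarrow> ('x, 'k) free_dilie" where
  "dilie_comm \<equiv> commutator dilie_mult"

abbreviation dilie_acomm ::
    "('x, 'k::field) free_dilie \<Rightarrow> ('x, 'k) free_dilie \<Rightarrow> ('x, 'k) free_dilie" where
  "dilie_acomm \<equiv> anticommutator dilie_mult"

global_interpretation dilie_lie: lie_alg dilie_scale dilie_comm
  by (rule dilie.lie_alg_comm)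

global_interpretation dilie_com_s: com_s_algebra dilie_scale dilie_acomm
  by (rule dilie.com_s_algebra_acomm)

text \<open>The homomorphism of Lie algebras \<open>Lie\<langle>X\<rangle> \<rightarrow> (di-Lie\<^sup>I\<langle>X\<rangle>, [_,_])\<close> that is the identity on
  generators; it evaluates a Lie bracket as a commutator.\<close>

lift_definition lie_to_dilie :: "('x, 'k::field) free_lie \<Rightarrow> ('x, 'k) free_dilie"
  is "na_extend dilie_scale dilie_comm dilie_gen"
  by (erule dilie_lie.ext_cong)
     (auto simp: lie_ids_def dilie_lie.ext_simps dilie_lie.alternating dilie_lie.jacobi)

lemma lie_to_dilie_gen: "lie_to_dilie (lie_gen x) = dilie_gen x"
  by transfer simp

lemma lie_to_dilie_mult:
  "lie_to_dilie (lie_mult a b) = dilie_comm (lie_to_dilie a) (lie_to_dilie b)"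
  by transfer (rule dilie_lie.ext_mult)

lemma linear_lie_to_dilie:
  "Vector_Spaces.linear lie_scale dilie_scale
     (lie_to_dilie :: ('x, 'k::field) free_lie \<Rightarrow> ('x, 'k) free_dilie)"
proof -
  have "lie_to_dilie (a + b) = lie_to_dilie a + lie_to_dilie b"
    "lie_to_dilie (lie_scale c a) = dilie_scale c (lie_to_dilie a)" 
    for a b :: "('x, 'k) free_lie" and c
    by (transfer, simp add: dilie_lie.ext_simps)+
  then show ?thesis
    by (simp add: Vector_Spaces.linear_iff lie.vector_space_axioms dilie.vector_space_axioms)
qed

text \<open>Likewise for \<open>Com\<^sup>S\<langle>X\<rangle> \<rightarrow> (di-Lie\<^sup>I\<langle>X\<rangle>, {_,_})\<close>.\<close>

lift_definition com_s_to_dilie :: "('x, 'k::field) free_com_s \<Rightarrow> ('x, 'k) free_dilie"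
  is "na_extend dilie_scale dilie_acomm dilie_gen"
  by (erule dilie_com_s.ext_cong)
     (auto simp: com_s_ids_def dilie_com_s.ext_simps dilie_com_s.metabelian
        intro: dilie_com_s.commute dilie_com_s.swap)

lemma com_s_to_dilie_gen: "com_s_to_dilie (com_s_gen x) = dilie_gen x"
  by transfer simp

lemma com_s_to_dilie_mult:
  "com_s_to_dilie (com_s_mult a b) = dilie_acomm (com_s_to_dilie a) (com_s_to_dilie b)"
  by transfer (rule dilie_com_s.ext_mult)

lemma linear_com_s_to_dilie:
  "Vector_Spaces.linear com_s_scale dilie_scale
     (com_s_to_dilie :: ('x, 'k::field) free_com_s \<Rightarrow> ('x, 'k) free_dilie)"
proof -
  have "com_s_to_dilie (a + b) = com_s_to_dilie a + com_s_to_dilie b"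
    "com_s_to_dilie (com_s_scale c a) = dilie_scale c (com_s_to_dilie a)" 
    for a b :: "('x, 'k) free_com_s" and c
    by (transfer, simp add: dilie_com_s.ext_simps)+
  then show ?thesis
    by (simp add: Vector_Spaces.linear_iff com_s.vector_space_axioms dilie.vector_space_axioms)
qed


section \<open>Bases and direct sums\<close>

definition is_basis :: "('k::field \<Rightarrow> 'v::ab_group_add \<Rightarrow> 'v) \<Rightarrow> 'v set \<Rightarrow> bool" where
  "is_basis scale B \<longleftrightarrow> \<not> module.dependent scale B \<and> module.span scale B = UNIV"

text \<open>Only \<open>n \<ge> 1\<close> is meaningful; \<open>drop 2 xs\<close> lists the indices \<open>i\<^sub>3, \<dots>, i\<^sub>n\<close>, so for
  \<open>n = 1\<close> these are the generators.\<close>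

definition C_S :: "nat \<Rightarrow> ('x::linorder, 'k::field) free_dilie set" where
  "C_S n = {foldl dilie_acomm (dilie_gen (hd xs)) (map dilie_gen (tl xs)) | xs.
     length xs = n \<and> (2 \<le> n \<longrightarrow> xs ! 0 \<le> xs ! 1) \<and> sorted (drop 2 xs)}"

text \<open>The square of \<open>Com\<^sup>S\<langle>X\<rangle>\<close>, i.e. its part of degree at least two.\<close>

definition com_s_square :: "('x, 'k::field) free_com_s set" where
  "com_s_square = module.span com_s_scale {com_s_mult a b | a b. True}"

definition sum_scale ::
    "'k::field \<Rightarrow> ('x, 'k) free_lie \<times> ('x, 'k) free_com_s \<Rightarrow> ('x, 'k) free_lie \<times> ('x, 'k) free_com_s" where
  "sum_scale c = map_prod (lie_scale c) (com_s_scale c)"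

end

theory Submission
  imports Defs "HOL-Library.Multiset"
begin

text \<open>Spanning: the anticommutators form a left ideal on which left multiplications by elements of the
  algebra commute, and the identity
  \<open>2{ab, c} = a{b, c} - b{a, c} + c{a, b}\<close> reduces every anticommutator to left-normed words in the
  generators.

  Independence: let \<open>R = K[t\<^sub>x, d\<^sub>x]\<close>. For a Lie polynomial \<open>u\<close> let \<open>ab(u) \<in> R\<close> be its image in the
  abelianization (with \<open>x \<mapsto> t\<^sub>x\<close>) and \<open>\<partial>u \<in> R\<close> its Fox derivative, so that \<open>\<partial>x = d\<^sub>x\<close> and
  \<open>\<partial>[u, v] = ab(u) \<partial>v - ab(v) \<partial>u\<close>. Then \<open>Lie\<langle>X\<rangle> \<times> R\<close> with the product
  \<open>(u, p) (v, q) = ([u, v] / 2, \<partial>u \<partial>v / 2 + ab(u) q)\<close> is an initial Lie dialgebra. The induced map from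
  the free one sends a Lie polynomial \<open>u\<close> to \<open>(u, 0)\<close> and a left-normed anticommutator word to
  \<open>(0, d\<^sub>i d\<^sub>j \<Prod> t\<^sub>k)\<close>, and distinct basis words give distinct monomials.\<close>

hide_const (open) Multiset.mult

section \<open>Two criteria for linear independence\<close>

section \<open>Linear algebra\<close>

context vector_space
begin

text \<open>Cutting a vanishing combination at \<open>A\<close> produces a vector that lies in both
  spans. It is zero, so each half is a vanishing combination of its own.\<close>

lemma independent_Un_disjoint_span:
  assumes "independent A" "independent B" "span A \<inter> span B \<subseteq> {0}"
  shows "independent (A \<union> B)"
  unfolding independent_explicit_module
proof (intro allI impI)
  fix t u v
  assume t: "finite t" "t \<subseteq> A \<union> B" "(\<Sum>v\<in>t. scale (u v) v) = 0" "v \<in> t"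
  let ?a = "\<Sum>v\<in>t \<inter> A. scale (u v) v" and ?b = "\<Sum>v\<in>t - A. scale (u v) v"
  have ab: "?a + ?b = 0"
    using t(1,3) by (simp add: sum.Int_Diff[of t _ A])
  have "?a \<in> span A" "?b \<in> span B"
    using t(2) by (intro span_sum span_scale span_base; blast)+
  moreover have "?a = - ?b" using ab by (simp add: eq_neg_iff_add_eq_0)
  ultimately have "?a = 0" using assms(3) span_neg[of ?b B] by auto
  with ab have "?b = 0" by simp
  show "u v = 0"
  proof (cases "v \<in> A")
    case True
    then show ?thesis
      using independentD[OF assms(1) _ _ \<open>?a = 0\<close>] t by blast
  next
    case False
    then show ?thesis
      using independentD[OF assms(2) _ _ \<open>?b = 0\<close>] t by blast
  qed
qed

end

text \<open>Lets independence be tested in another space, such as one of polynomials. Injectivity is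
  asked on \<open>B\<close> alone because some of the maps used later have large kernels.\<close>

lemma (in vector_space_pair) independent_if_independent_image:
  assumes f: "Vector_Spaces.linear s1 s2 f" and "vs2.independent (f ` B)" "inj_on f B"
  shows "vs1.independent B"
proof
  assume "vs1.dependent B"
  then obtain a where a: "a \<in> B" "a \<in> vs1.span (B - {a})"
    unfolding vs1.dependent_def by blast
  then have "f a \<in> vs2.span (f ` (B - {a}))"
    using linear_span_image[OF f] by blast
  moreover have "f ` (B - {a}) = f ` B - {f a}"
    using assms(3) a(1) by (auto simp: inj_on_def)
  ultimately show False
    using assms(2) a(1) unfolding vs2.dependent_def by auto
qed


section \<open>Words in the generators span each free algebra\<close>

section \<open>Words span free algebras\<close>

lemma word_eval_na:
  "word_eval (\<odot>) na_gen w = (Poly_Mapping.single w 1 :: ('x, 'k::field) free_nonassoc)"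
  by (induction w) (simp_all add: na_gen_def na_mult_def)

context nonassoc_algebra
begin

text \<open>\<open>T\<close> stands for the quotient maps onto the three free algebras. Every
  monomial is a scalar times a word evaluated at the generators, and \<open>T\<close> commutes with
  evaluation.\<close>

lemma span_words_UNIV:
  fixes T :: "('x, 'k) free_nonassoc \<Rightarrow> 'a"
  assumes T: "\<And>p q. T (p + q) = T p + T q" "\<And>c p. T (na_scale c p) = scale c (T p)"
      "\<And>p q. T (p \<odot> q) = mult (T p) (T q)"
    and "surj T"
  shows "span (range (word_eval mult (\<lambda>x. T (na_gen x)))) = UNIV" (is "span ?W = UNIV")
proof -
  have word: "T (Poly_Mapping.single w c) \<in> span ?W" for w c
  proof -
    have "T (word_eval (\<odot>) na_gen w) = word_eval mult (\<lambda>x. T (na_gen x)) w"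
      by (induction w) (simp_all add: T)
    moreover have "Poly_Mapping.single w c = na_scale c (word_eval (\<odot>) na_gen w)"
      by (simp add: word_eval_na na_scale_single)
    ultimately show ?thesis
      by (simp only: T) (blast intro: span_scale span_base)
  qed
  have "T p \<in> span ?W" for p
  proof (induction p rule: update_induct)
    case const
    have "T 0 = 0" using T(1)[of 0 0] by simp
    then show ?case by (simp add: span_zero)
  next
    case (update p w c)
    \<comment> \<open>The key \<open>w\<close> is new, so updating amounts to adding a
      monomial.\<close>
    then have "Poly_Mapping.update w c p = p + Poly_Mapping.single w c"
      by (intro poly_mapping_eqI) (auto simp: lookup_update lookup_add lookup_single in_keys_iff)
    then show ?case using update by (simp add: T(1) span_add word)
  qed
  then show ?thesis using assms(4) by (metis UNIV_eq_I surjE)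
qed

end

lemma span_dilie_words:
  "dilie.span (range (word_eval dilie_mult dilie_gen)) = (UNIV :: ('x, 'k::field) free_dilie set)"
proof -
  have "surj (abs_free_dilie :: _ \<Rightarrow> ('x, 'k) free_dilie)"
    by (metis Quotient_free_dilie Quotient_abs_rep surj_def)
  have gen: "(\<lambda>x. abs_free_dilie (na_gen x)) = (dilie_gen :: 'x \<Rightarrow> ('x, 'k) free_dilie)"
    by (simp add: fun_eq_iff dilie_gen.abs_eq)
  show ?thesis
    using \<open>surj _\<close> dilie.span_words_UNIV[of "abs_free_dilie :: _ \<Rightarrow> ('x, 'k) free_dilie"]
    unfolding gen
    by (simp add: plus_free_dilie.abs_eq dilie_scale.abs_eq dilie_mult.abs_eq)
qed

lemma span_lie_words:
  "lie.span (range (word_eval lie_mult lie_gen)) = (UNIV :: ('x, 'k::field) free_lie set)"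
proof -
  have "surj (abs_free_lie :: _ \<Rightarrow> ('x, 'k) free_lie)"
    by (metis Quotient_free_lie Quotient_abs_rep surj_def)
  have gen: "(\<lambda>x. abs_free_lie (na_gen x)) = (lie_gen :: 'x \<Rightarrow> ('x, 'k) free_lie)"
    by (simp add: fun_eq_iff lie_gen.abs_eq)
  show ?thesis
    using \<open>surj _\<close> lie.span_words_UNIV[of "abs_free_lie :: _ \<Rightarrow> ('x, 'k) free_lie"]
    unfolding gen
    by (simp add: plus_free_lie.abs_eq lie_scale.abs_eq lie_mult.abs_eq)
qed

lemma span_com_s_words:
  "com_s.span (range (word_eval com_s_mult com_s_gen)) = (UNIV :: ('x, 'k::field) free_com_s set)"
proof -
  have "surj (abs_free_com_s :: _ \<Rightarrow> ('x, 'k) free_com_s)"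
    by (metis Quotient_free_com_s Quotient_abs_rep surj_def)
  have gen: "(\<lambda>x. abs_free_com_s (na_gen x)) = (com_s_gen :: 'x \<Rightarrow> ('x, 'k) free_com_s)"
    by (simp add: fun_eq_iff com_s_gen.abs_eq)
  show ?thesis
    using \<open>surj _\<close> com_s.span_words_UNIV[of "abs_free_com_s :: _ \<Rightarrow> ('x, 'k) free_com_s"]
    unfolding gen
    by (simp add: plus_free_com_s.abs_eq com_s_scale.abs_eq com_s_mult.abs_eq)
qed


section \<open>Left-normed words and their span in \<open>Com^S\<close> algebras\<close>

section \<open>Left-normed words\<close>

text \<open>The shape of the elements of \<open>C_S\<close>, for an arbitrary product, so that one
  list of letters can be evaluated in \<open>Com^S\<close>, in the dialgebra and in the
  model.\<close>

definition left_normed :: "('a \<Rightarrow> 'a \<Rightarrow> 'a) \<Rightarrow> ('x \<Rightarrow> 'a) \<Rightarrow> 'x list \<Rightarrow> 'a" where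
  "left_normed mult g xs = foldl mult (g (hd xs)) (map g (tl xs))"

text \<open>Index lists of the elements of \<open>C_S n\<close> for \<open>n\<close> \<ge> 2. Single
  letters stay out because the generators already belong to the Lie part.\<close>

definition canonical_words :: "'x::linorder list set" where
  "canonical_words = {xs. 2 \<le> length xs \<and> xs ! 0 \<le> xs ! 1 \<and> sorted (drop 2 xs)}"

lemma left_normed_single [simp]: "left_normed mult g [x] = g x"
  by (simp add: left_normed_def)

lemma left_normed_Cons2: "left_normed mult g (x # y # ys) = foldl mult (mult (g x) (g y)) (map g ys)"
  by (simp add: left_normed_def)

lemma left_normed_snoc:
  "xs \<noteq> [] \<Longrightarrow> left_normed mult g (xs @ [y]) = mult (left_normed mult g xs) (g y)"
  by (simp add: left_normed_def)

lemma left_normed_hom: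
  assumes "\<And>a b. T (mult a b) = mult' (T a) (T b)"
  shows "T (left_normed mult g xs) = left_normed mult' (\<lambda>x. T (g x)) xs"
proof -
  have "T (foldl mult a (map g ys)) = foldl mult' (T a) (map (\<lambda>x. T (g x)) ys)" for a ys
    by (induction ys arbitrary: a) (simp_all add: assms)
  then show ?thesis by (simp add: left_normed_def)
qed

lemma canonical_wordsE:
  assumes "xs \<in> canonical_words"
  obtains x y ys where "xs = x # y # ys" "x \<le> y" "sorted ys"
  using assms by (cases xs; cases "tl xs") (auto simp: canonical_words_def)

lemma canonical_words_Cons2: "x # y # ys \<in> canonical_words \<longleftrightarrow> x \<le> y \<and> sorted ys"
  by (simp add: canonical_words_def)

lemma Un_C_S_2: "(\<Union>n\<in>{2..}. C_S n) = left_normed dilie_acomm dilie_gen ` canonical_words"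
  by (auto simp: C_S_def canonical_words_def left_normed_def image_iff)

lemma Un_C_S_1:
  "(\<Union>n\<in>{1..}. C_S n) = (range dilie_gen \<union> (\<Union>n\<in>{2..}. C_S n) :: ('x::linorder, 'k::field) free_dilie set)"
proof -
  have "{1..} = insert 1 {2::nat..}" by auto
  moreover have "C_S 1 = (range dilie_gen :: ('x, 'k) free_dilie set)"
    by (force simp: C_S_def length_Suc_conv image_iff)
  ultimately show ?thesis by (simp only: UN_insert)
qed

context com_s_algebra
begin

lemma foldl_mset_cong:
  assumes "mset ys = mset zs"
  shows "foldl mult (mult a b) ys = foldl mult (mult a b) zs"
proof -
  let ?P = "{mult a b | a b. True}"
  \<comment> \<open>The identity \<open>swap\<close> exchanges two right factors only behind a
    product. Making \<open>f\<close> the identity off the products turns the maps \<open>f y\<close>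
    into everywhere commuting ones, so a fold over them depends on the multiset alone.\<close>
  define f where "f y p = (if p \<in> ?P then mult p y else p)" for y p
  have f: "foldl mult p ys = fold f ys p" if "p \<in> ?P" for p ys
    using that by (induction ys arbitrary: p) (auto simp: f_def)
  have P: "mult c d \<in> ?P" for c d by blast
  have f_mult: "f y (mult c d) = mult (mult c d) y" for y c d
    by (auto simp: f_def)
  have "f x (f y p) = f y (f x p)" for x y p
  proof (cases "p \<in> ?P")
    case True
    then obtain a b where p: "p = mult a b" by auto
    show ?thesis by (simp add: f_mult p swap[of a b])
  qed (simp add: f_def)
  then have "f x \<circ> f y = f y \<circ> f x" for x y
    by (simp add: fun_eq_iff)
  then have "fold f ys = fold f zs"
    using assms by (intro fold_multiset_equiv) auto
  then show ?thesis by (simp only: f[OF P])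
qed

abbreviation left_normed_span :: "('x::linorder \<Rightarrow> 'b) \<Rightarrow> 'b set" where
  "left_normed_span g \<equiv> span (left_normed mult g ` canonical_words)"

text \<open>Commutativity orders the first two letters, and \<open>foldl_mset_cong\<close> sorts the
  others.\<close>

lemma left_normed_canonical:
  assumes "2 \<le> length xs"
  shows "left_normed mult g xs \<in> left_normed mult g ` canonical_words"
proof -
  obtain x y ys where xs: "xs = x # y # ys"
    using assms by (cases xs; cases "tl xs") auto
  have "left_normed mult g xs = left_normed mult g (min x y # max x y # sort ys)"
    using foldl_mset_cong[where ys = "map g ys" and zs = "map g (sort ys)"]
    by (auto simp: xs left_normed_Cons2 min_def max_def commute[of "g y"])
  moreover have "min x y # max x y # sort ys \<in> canonical_words"
    by (auto simp: canonical_words_Cons2 min_def max_def)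
  ultimately show ?thesis by blast
qed

lemma left_normed_in_span: "2 \<le> length xs \<Longrightarrow> left_normed mult g xs \<in> left_normed_span g"
  by (blast intro: span_base left_normed_canonical)

lemma gen_mult_gen: "mult (g x) (g y) \<in> left_normed_span g"
  using left_normed_in_span[of "[x, y]" g] by (simp add: left_normed_Cons2)

lemma left_normed_span_mult_gen:
  assumes "v \<in> left_normed_span g"
  shows "mult v (g y) \<in> left_normed_span g"
  using assms
proof (induction rule: span_induct_alt)
  case base
  then show ?case by (simp add: span_zero)
next
  case (step c w v)
  then obtain xs where xs: "w = left_normed mult g xs" "xs \<in> canonical_words" by blast
  then have "2 \<le> length (xs @ [y])" "xs \<noteq> []" by (auto simp: canonical_words_def)
  then have "mult w (g y) \<in> left_normed_span g"
    using left_normed_in_span[of "xs @ [y]" g] by (simp add: xs left_normed_snoc)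
  then show ?case
    using step by (simp add: mult_add_left mult_scale_left span_add span_scale)
qed

lemma left_normed_is_product:
  assumes "2 \<le> length xs"
  shows "\<exists>a b. left_normed mult g xs = mult a b"
proof (cases xs rule: rev_cases)
  case (snoc ys y)
  with assms have "ys \<noteq> []" by auto
  then show ?thesis unfolding snoc by (subst left_normed_snoc) auto
qed (use assms in simp)

lemma span_square_square:
  assumes "u \<in> left_normed_span g" "v \<in> left_normed_span g"
  shows "mult u v = 0"
proof -
  have 1: "mult w v = 0" if w: "w \<in> left_normed mult g ` canonical_words" for w
    using assms(2)
  proof (induction rule: span_induct_alt)
    case (step c w' v)
    have "\<exists>a b. w = mult a b" "\<exists>a b. w' = mult a b"
      using w step left_normed_is_product by (auto simp: canonical_words_def)
    then show ?case using step by (auto simp: mult_add_right mult_scale_right metabelian)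
  qed simp
  show ?thesis
    using assms(1) by (induction rule: span_induct_alt) (auto simp: mult_add_left mult_scale_left 1)
qed

text \<open>A letter times a letter is a word of length two, a letter can be appended to a longer
  word, and two longer words multiply to zero. The union, though not a subspace, therefore contains
  the value of every word.\<close>

lemma mult_in_left_normed_span:
  assumes "a \<in> range g \<union> left_normed_span g" "b \<in> range g \<union> left_normed_span g"
  shows "mult a b \<in> left_normed_span g"
proof -
  consider "a \<in> range g" "b \<in> range g" | "a \<in> left_normed_span g" "b \<in> range g"
    | "a \<in> range g" "b \<in> left_normed_span g"
    | "a \<in> left_normed_span g" "b \<in> left_normed_span g"
    using assms by blast
  then show ?thesis
  proof cases
    case 3
    then show ?thesis by (subst commute) (auto intro: left_normed_span_mult_gen)
  qed (auto intro: gen_mult_gen left_normed_span_mult_gen simp: span_square_square span_zero)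
qed

lemma word_eval_in: "word_eval mult g w \<in> range g \<union> left_normed_span g"
  by (induction w) (simp_all add: mult_in_left_normed_span)

end

section \<open>Reduction of the free dialgebra to Lie elements plus canonical words\<close>

section \<open>Spanning\<close>

text \<open>The identities for anticommutators and products below determine only the double of an
  element; this divides by two.\<close>

lemma (in vector_space) half_in_subspace:
  assumes "subspace S" "a + a \<in> S" "(2 :: 'a) \<noteq> 0"
  shows "a \<in> S"
proof -
  have "a = scale (1 / 2) (a + a)"
    using assms(3) scale_left_distrib[of "1 / 2" "1 / 2" a]
    by (simp add: scale_right_distrib field_sum_of_halves)
  then show ?thesis using subspace_scale[OF assms(1,2)] by metis
qed

context initial_lie_dialgebra
begin

text \<open>After \<open>leibniz\<close> the two sides differ by exactly the left-hand side of
  \<open>initial\<close>. Read from left to right, the identity breaks up the product inside an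
  anticommutator.\<close>

lemma acomm_mult_left:
  "acomm (mult a b) c + acomm (mult a b) c
     = mult a (acomm b c) - mult b (acomm a c) + mult c (acomm a b)"
proof -
  have "acomm (mult a b) c + acomm (mult a b) c
      - (mult a (acomm b c) - mult b (acomm a c) + mult c (acomm a b))
    = mult a (mult b c) - mult a (mult c b) - mult b (mult a c)
      + mult b (mult c a) + mult c (mult a b) - mult c (mult b a)"
    by (simp add: anticommutator_def mult_simps leibniz)
  then show ?thesis by (simp add: initial)
qed

lemma mult_add_mult:
  "mult a b + mult a b = comm a b + acomm a b"
  by (simp add: commutator_def anticommutator_def)

end

lemma dilie_mult_span_left:
  assumes "v \<in> dilie_com_s.left_normed_span g"
  shows "dilie_mult v c = 0"
  using assms
proof (induction rule: dilie.span_induct_alt)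
  case (step r w v)
  then have "\<exists>a b. w = dilie_acomm a b"
    using dilie_com_s.left_normed_is_product by (auto simp: canonical_words_def)
  then show ?case
    using step by (auto simp: dilie.mult_simps dilie.mult_acomm_left)
qed simp

text \<open>For a generator \<open>x\<close> the product \<open>x v\<close> equals the
  anticommutator of \<open>v\<close> and \<open>x\<close>, since \<open>v x = 0\<close>, so it
  appends a letter. By \<open>leibniz\<close>, multiplication by a product is the commutator of the
  two multiplications.\<close>

lemma dilie_mult_span_right:
  assumes "v \<in> dilie_com_s.left_normed_span dilie_gen"
  shows "dilie_mult a v \<in> dilie_com_s.left_normed_span dilie_gen" (is "_ \<in> ?V")
proof -
  have word: "dilie_mult (word_eval dilie_mult dilie_gen w) v \<in> ?V" if "v \<in> ?V" for w v
    using that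
  proof (induction w arbitrary: v)
    case (Gen x)
    have "dilie_acomm v (dilie_gen x) \<in> ?V"
      using Gen by (rule dilie_com_s.left_normed_span_mult_gen)
    then show ?case
      using dilie_mult_span_left[OF Gen]
      by (simp add: anticommutator_def[of dilie_mult v "dilie_gen x"])
  next
    case (Node u w)
    then show ?case by (simp add: dilie.leibniz dilie.span_diff)
  qed
  have "a \<in> dilie.span (range (word_eval dilie_mult dilie_gen))"
    by (simp add: span_dilie_words)
  then show ?thesis
    by (induction rule: dilie.span_induct_alt)
      (auto simp: dilie.mult_simps dilie.span_zero intro!: dilie.span_add dilie.span_scale word assms)
qed

text \<open>Induction on the total size of two words by \<open>acomm_mult_left\<close>; the outer
  multiplications are harmless because the span is a left ideal. Bilinearity then passes from words
  to all elements.\<close>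

lemma dilie_acomm_in_span:
  fixes a b :: "('x::linorder, 'k::field_char_0) free_dilie"
  shows "dilie_acomm a b \<in> dilie_com_s.left_normed_span dilie_gen" (is "_ \<in> ?V")
proof -
  let ?e = "word_eval dilie_mult dilie_gen :: 'x word \<Rightarrow> ('x, 'k) free_dilie"
  have word: "dilie_acomm (?e u) (?e v) \<in> ?V" for u v
  proof (induction "size u + size v" arbitrary: u v rule: less_induct)
    case less
    \<comment> \<open>\<open>Node p q\<close> counts one more than its parts, so every pair among
      the three factors has smaller total size than the pair under consideration.\<close>
    have step: "dilie_acomm (?e (Node p q)) (?e r) \<in> ?V"
      if "size p + size q + size r < size u + size v" for p q r
    proof -
      have "dilie_acomm (?e p) (?e q) \<in> ?V" "dilie_acomm (?e q) (?e r) \<in> ?V"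
        "dilie_acomm (?e p) (?e r) \<in> ?V"
        using that by (auto intro!: less)
      then have "dilie_mult (?e p) (dilie_acomm (?e q) (?e r)) - dilie_mult (?e q) (dilie_acomm (?e p) (?e r))
          + dilie_mult (?e r) (dilie_acomm (?e p) (?e q)) \<in> ?V"
        by (intro dilie.span_add dilie.span_diff dilie_mult_span_right)
      then have "dilie_acomm (?e (Node p q)) (?e r) + dilie_acomm (?e (Node p q)) (?e r) \<in> ?V"
        by (simp only: word_eval.simps dilie.acomm_mult_left)
      then show ?thesis
        by (rule dilie.half_in_subspace[OF dilie.subspace_span]) simp
    qed
    show ?case
    proof (cases u)
      case u: (Gen x)
      show ?thesis
      proof (cases v)
        case (Gen y)
        then show ?thesis using u by (simp add: dilie_com_s.gen_mult_gen)
      next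
        case (Node p q)
        then show ?thesis
          using step[of p q u] by (simp add: dilie_com_s.commute[of "?e u"])
      qed
    next
      case (Node p q)
      then show ?thesis using step[of p q v] by simp
    qed
  qed
  have b: "dilie_acomm (?e u) b \<in> ?V" for u
  proof -
    have "b \<in> dilie.span (range ?e)" by (simp add: span_dilie_words)
    then show ?thesis
      by (induction rule: dilie.span_induct_alt)
        (auto simp: dilie_com_s.mult_simps dilie.span_zero
          intro!: dilie.span_add dilie.span_scale word)
  qed
  have "a \<in> dilie.span (range ?e)" by (simp add: span_dilie_words)
  then show ?thesis
    by (induction rule: dilie.span_induct_alt)
      (auto simp: dilie_com_s.mult_simps dilie.span_zero
        intro!: dilie.span_add dilie.span_scale b)
qed

interpretation lie_to_dilie: Vector_Spaces.linear lie_scale dilie_scale lie_to_dilie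
  by (rule linear_lie_to_dilie)

interpretation com_s_to_dilie: Vector_Spaces.linear com_s_scale dilie_scale com_s_to_dilie
  by (rule linear_com_s_to_dilie)

text \<open>The sums \<open>u + v\<close> are closed under products: \<open>v\<close> annihilates
  from the left, \<open>u v'\<close> stays in the left ideal, and twice \<open>u u'\<close> is a Lie
  bracket plus an anticommutator.\<close>

lemma dilie_decompose:
  fixes a :: "('x::linorder, 'k::field_char_0) free_dilie"
  obtains u v where "v \<in> dilie_com_s.left_normed_span dilie_gen" "a = lie_to_dilie u + v"
proof -
  let ?V = "dilie_com_s.left_normed_span (dilie_gen :: 'x \<Rightarrow> ('x, 'k) free_dilie)"
  let ?S = "{lie_to_dilie u + v | u v. v \<in> ?V} :: ('x, 'k) free_dilie set"
  have S_eq: "?S = {x + y | x y. x \<in> range lie_to_dilie \<and> y \<in> ?V}" by blast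
  have S: "dilie.subspace ?S"
    unfolding S_eq
    using dilie.subspace_sums[OF lie_to_dilie.subspace_image[OF lie.subspace_UNIV] dilie.subspace_span,
        of "left_normed dilie_acomm dilie_gen ` canonical_words :: ('x, 'k) free_dilie set"]
    by simp
  have "word_eval dilie_mult dilie_gen w \<in> ?S" for w
  proof (induction w)
    case (Gen x)
    have "word_eval dilie_mult dilie_gen (Gen x) = lie_to_dilie (lie_gen x) + 0"
      by (simp add: lie_to_dilie_gen)
    then show ?case using dilie.span_zero by blast
  next
    case (Node w w')
    then obtain u v u' v' where uv: "v \<in> ?V" "v' \<in> ?V"
        "word_eval dilie_mult dilie_gen w = lie_to_dilie u + v"
        "word_eval dilie_mult dilie_gen w' = lie_to_dilie u' + v'"
      by blast
    let ?p = "dilie_mult (lie_to_dilie u) (lie_to_dilie u')"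
    have "?p + ?p = lie_to_dilie (lie_mult u u') + dilie_acomm (lie_to_dilie u) (lie_to_dilie u')"
      by (simp add: dilie.mult_add_mult lie_to_dilie_mult)
    then have "?p + ?p \<in> ?S" using dilie_acomm_in_span by blast
    then have "?p \<in> ?S" by (rule dilie.half_in_subspace[OF S]) simp
    moreover have "dilie_mult (lie_to_dilie u) v' \<in> ?V"
      using uv(2) by (rule dilie_mult_span_right)
    then have "lie_to_dilie 0 + dilie_mult (lie_to_dilie u) v' \<in> ?S" by blast
    ultimately have "?p + (lie_to_dilie 0 + dilie_mult (lie_to_dilie u) v') \<in> ?S"
      by (rule dilie.subspace_add[OF S])
    then show ?case
      using uv(1) by (simp add: uv(3,4) dilie.mult_simps dilie_mult_span_left lie_to_dilie.zero)
  qed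
  then have "dilie.span (range (word_eval dilie_mult dilie_gen)) \<subseteq> ?S"
    using S by (intro dilie.span_minimal) auto
  then have "a \<in> ?S" by (auto simp: span_dilie_words)
  then show ?thesis using that by blast
qed

section \<open>Canonical words in the free \<open>Com^S\<close> algebra and its square\<close>

lemma span_com_s_left_normed:
  "com_s.span (range com_s_gen \<union> left_normed com_s_mult com_s_gen ` canonical_words)
    = (UNIV :: ('x::linorder, 'k::field) free_com_s set)" (is "com_s.span ?B = _")
proof -
  have "range com_s_gen \<union> com_s.left_normed_span com_s_gen \<subseteq> com_s.span ?B"
    using com_s.span_superset[of ?B] by (intro Un_least com_s.span_mono Un_upper2) blast
  then have "range (word_eval com_s_mult com_s_gen :: _ \<Rightarrow> ('x, 'k) free_com_s) \<subseteq> com_s.span ?B"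
    using com_s.word_eval_in by (intro image_subsetI) (rule subsetD)
  then have "com_s.span (range (word_eval com_s_mult com_s_gen)) \<subseteq> com_s.span ?B"
    by (intro com_s.span_minimal) auto
  then show ?thesis by (simp add: span_com_s_words top.extremum_unique)
qed

text \<open>Bilinearity expands a product into products of words, which
  \<open>mult_in_left_normed_span\<close> handles; conversely a canonical word is itself a
  product.\<close>

lemma com_s_square_eq:
  "com_s_square = (com_s.left_normed_span com_s_gen :: ('x::linorder, 'k::field) free_com_s set)"
  (is "_ = ?V")
proof
  have word: "com_s_mult a (word_eval com_s_mult com_s_gen w) \<in> ?V" for a w
  proof -
    have "a \<in> com_s.span (range (word_eval com_s_mult com_s_gen))"
      by (simp add: span_com_s_words)
    then show ?thesis
      by (induction rule: com_s.span_induct_alt)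
        (auto simp: com_s.mult_simps com_s.span_zero
          intro!: com_s.span_add com_s.span_scale com_s.mult_in_left_normed_span com_s.word_eval_in)
  qed
  have "com_s_mult a b \<in> ?V" for a b
  proof -
    have "b \<in> com_s.span (range (word_eval com_s_mult com_s_gen))"
      by (simp add: span_com_s_words)
    then show ?thesis
      by (induction rule: com_s.span_induct_alt)
        (auto simp: com_s.mult_simps com_s.span_zero intro!: com_s.span_add com_s.span_scale word)
  qed
  then show "com_s_square \<subseteq> ?V"
    unfolding com_s_square_def by (intro com_s.span_minimal) auto
  show "?V \<subseteq> com_s_square"
    unfolding com_s_square_def using com_s.left_normed_is_product
    by (intro com_s.span_mono) (fastforce simp: canonical_words_def)
qed

lemma com_s_to_dilie_left_normed:
  "com_s_to_dilie (left_normed com_s_mult com_s_gen xs) = left_normed dilie_acomm dilie_gen xs"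
  using left_normed_hom[where T = com_s_to_dilie and mult = com_s_mult and mult' = dilie_acomm
      and g = com_s_gen and xs = xs]
  by (simp add: com_s_to_dilie_mult com_s_to_dilie_gen)

lemma com_s_to_dilie_square:
  "com_s_to_dilie ` com_s_square
    = dilie_com_s.left_normed_span (dilie_gen :: 'x::linorder \<Rightarrow> ('x, 'k::field) free_dilie)"
  unfolding com_s_square_eq com_s_to_dilie.span_image[symmetric]
  by (simp add: image_image com_s_to_dilie_left_normed)

section \<open>Polynomials and Fox derivatives\<close>

section \<open>A model of the free initial Lie dialgebra\<close>

text \<open>A pair \<open>(T, D)\<close> of multisets stands for the monomial \<open>\<Prod>x\<in>T. t\<^sub>x * \<Prod>x\<in>D. d\<^sub>x\<close>.\<close>

type_synonym ('x, 'k) fox = "'x multiset \<times> 'x multiset \<Rightarrow>\<^sub>0 'k"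

text \<open>Scaling by means of a constant polynomial reduces its compatibility with products to the
  laws of a commutative ring.\<close>

definition fox_scale :: "'k::field \<Rightarrow> ('x, 'k) fox \<Rightarrow> ('x, 'k) fox" where
  "fox_scale c p = Poly_Mapping.single 0 c * p"

lemma lookup_fox_scale: "Poly_Mapping.lookup (fox_scale c p) m = c * Poly_Mapping.lookup p m"
  by (simp add: fox_scale_def Poly_Mapping.map.rep_eq when_def flip: mult_map_scale_conv_mult)

lemma vector_space_fox: "vector_space fox_scale"
  by standard (auto intro!: poly_mapping_eqI simp: lookup_fox_scale lookup_add algebra_simps)

global_interpretation fox: vector_space fox_scale
  by (rule vector_space_fox)

lemma fox_scale_mult_left: "fox_scale c p * q = fox_scale c (p * q)"
  by (simp add: fox_scale_def mult.assoc)

lemma fox_scale_mult_right: "p * fox_scale c q = fox_scale c (p * q)"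
  by (simp add: fox_scale_def mult.left_commute)

lemma inj_fox_single: "inj (\<lambda>m. Poly_Mapping.single m 1 :: ('x, 'k::field) fox)"
  by (rule injI) (metis lookup_single_eq lookup_single_not_eq zero_neq_one)

lemma fox_independent_monomials:
  "fox.independent (range (\<lambda>m. Poly_Mapping.single m 1 :: ('x, 'k::field) fox))"
  unfolding fox.independent_explicit_module
proof (intro allI impI)
  fix S :: "('x, 'k) fox set" and u p
  assume S: "finite S" "S \<subseteq> range (\<lambda>m. Poly_Mapping.single m 1)" "(\<Sum>v\<in>S. fox_scale (u v) v) = 0" "p \<in> S"
  then obtain m where p: "p = Poly_Mapping.single m 1" by blast
  \<comment> \<open>Comparing coefficients at \<open>m\<close> isolates \<open>u p\<close>, since no
    other monomial in \<open>S\<close> has a nonzero coefficient there.\<close>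
  have "0 = (\<Sum>v\<in>S. u v * Poly_Mapping.lookup v m)"
    using arg_cong[OF S(3), of "\<lambda>q. Poly_Mapping.lookup q m"] by (simp add: lookup_sum lookup_fox_scale)
  also have "\<dots> = (\<Sum>v\<in>S. if v = p then u p else 0)"
  proof (intro sum.cong refl)
    fix v assume "v \<in> S"
    then obtain m' where v: "v = Poly_Mapping.single m' 1" using S(2) by blast
    then show "u v * Poly_Mapping.lookup v m = (if v = p then u p else 0)"
      using inj_eq[OF inj_fox_single, of m' m] by (auto simp: p lookup_single when_def)
  qed
  also have "\<dots> = u p" using S by simp
  finally show "u p = 0" by simp
qed

definition fox_pair_scale :: "'k::field \<Rightarrow> ('x, 'k) fox \<times> ('x, 'k) fox \<Rightarrow> ('x, 'k) fox \<times> ('x, 'k) fox" where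
  "fox_pair_scale c p = (fox_scale c (fst p), fox_scale c (snd p))"

text \<open>The semidirect product of the polynomial ring, taken as an abelian Lie algebra, with
  itself as a module under multiplication.\<close>

definition fox_bracket ::
    "('x, 'k::field) fox \<times> ('x, 'k) fox \<Rightarrow> ('x, 'k) fox \<times> ('x, 'k) fox \<Rightarrow> ('x, 'k) fox \<times> ('x, 'k) fox" where
  "fox_bracket p q = (0, fst p * snd q - fst q * snd p)"

lemmas fox_scale_simps = fox_scale_mult_left fox_scale_mult_right
  fox.scale_right_distrib fox.scale_left_distrib fox.scale_right_diff_distrib

global_interpretation fox_pair: lie_alg fox_pair_scale fox_bracket
  by standard
    (simp_all add: fox_pair_scale_def fox_bracket_def prod_eq_iff fox_scale_simps algebra_simps)

text \<open>The embedding of Magnus type of the free metabelian Lie algebra: the first component is the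
  abelianization and the second one collects the Fox derivatives.\<close>

lift_definition magnus :: "('x, 'k::field) free_lie \<Rightarrow> ('x, 'k) fox \<times> ('x, 'k) fox"
  is "na_extend fox_pair_scale fox_bracket
    (\<lambda>x. (Poly_Mapping.single ({#x#}, {#}) 1, Poly_Mapping.single ({#}, {#x#}) 1))"
  by (erule fox_pair.ext_cong)
     (auto simp: lie_ids_def fox_pair.ext_simps fox_pair.alternating fox_pair.jacobi)

lemma magnus_gen:
  "magnus (lie_gen x) = (Poly_Mapping.single ({#x#}, {#}) 1, Poly_Mapping.single ({#}, {#x#}) 1)"
  by transfer simp

lemma magnus_mult: "magnus (lie_mult a b) = fox_bracket (magnus a) (magnus b)"
  by transfer (rule fox_pair.ext_mult)

lemma magnus_add: "magnus (a + b) = magnus a + magnus b"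
  by transfer (rule fox_pair.ext_add)

lemma magnus_scale: "magnus (lie_scale c a) = fox_pair_scale c (magnus a)"
  by transfer (rule fox_pair.ext_scale)

definition lie_ab :: "('x, 'k::field) free_lie \<Rightarrow> ('x, 'k) fox" where
  "lie_ab u = fst (magnus u)"

definition lie_fox :: "('x, 'k::field) free_lie \<Rightarrow> ('x, 'k) fox" where
  "lie_fox u = snd (magnus u)"

lemma lie_ab_simps:
  "lie_ab (lie_gen x) = Poly_Mapping.single ({#x#}, {#}) 1"
  "lie_ab (lie_mult a b) = 0"
  "lie_ab (a + b) = lie_ab a + lie_ab b"
  "lie_ab (lie_scale c a) = fox_scale c (lie_ab a)"
  by (simp_all add: lie_ab_def magnus_gen magnus_mult magnus_add magnus_scale
      fox_bracket_def fox_pair_scale_def)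

lemma lie_fox_simps:
  "lie_fox (lie_gen x) = Poly_Mapping.single ({#}, {#x#}) 1"
  "lie_fox (lie_mult a b) = lie_ab a * lie_fox b - lie_ab b * lie_fox a"
  "lie_fox (a + b) = lie_fox a + lie_fox b"
  "lie_fox (lie_scale c a) = fox_scale c (lie_fox a)"
  by (simp_all add: lie_ab_def lie_fox_def magnus_gen magnus_mult magnus_add magnus_scale
      fox_bracket_def fox_pair_scale_def)

lemma linear_lie_ab:
  "Vector_Spaces.linear lie_scale fox_scale (lie_ab :: ('x, 'k::field) free_lie \<Rightarrow> _)"
  by (simp add: Vector_Spaces.linear_iff lie.vector_space_axioms vector_space_fox lie_ab_simps)

section \<open>The model and the homomorphism from the free dialgebra\<close>

type_synonym ('x, 'k) model = "('x, 'k) free_lie \<times> ('x, 'k) fox"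

definition model_scale :: "'k::field \<Rightarrow> ('x, 'k) model \<Rightarrow> ('x, 'k) model" where
  "model_scale c p = (lie_scale c (fst p), fox_scale c (snd p))"

text \<open>The halves are chosen so that on pairs \<open>(u, 0)\<close> the commutator is the Lie
  bracket and the anticommutator is the product of the Fox derivatives. The last summand lets a Lie
  element act through its abelianization.\<close>

definition model_mult :: "('x, 'k::field) model \<Rightarrow> ('x, 'k) model \<Rightarrow> ('x, 'k) model" where
  "model_mult p q = (lie_scale (1 / 2) (lie_mult (fst p) (fst q)),
     fox_scale (1 / 2) (lie_fox (fst p) * lie_fox (fst q)) + lie_ab (fst p) * snd q)"

lemma lie_mult_commute: "lie_mult b a = - lie_mult a b"
proof -
  have "lie_mult (a + b) (a + b) = lie_mult a b + lie_mult b a"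
    unfolding lie.mult_simps by (simp add: lie.alternating)
  then show ?thesis by (simp add: lie.alternating eq_neg_iff_add_eq_0 add.commute)
qed

lemma lie_mult_leibniz:
  "lie_mult (lie_mult a b) c = lie_mult a (lie_mult b c) - lie_mult b (lie_mult a c)"
  using lie.jacobi[of a b c]
  by (simp add: lie_mult_commute[of c "lie_mult a b"] lie_mult_commute[of c a] lie.mult_simps
      algebra_simps)

lemma nonassoc_algebra_model:
  "nonassoc_algebra (model_scale :: 'k::field \<Rightarrow> ('x, 'k) model \<Rightarrow> _) model_mult"
  by standard
    (simp_all add: model_scale_def model_mult_def prod_eq_iff lie.mult_simps lie_ab_simps lie_fox_simps
      fox_scale_simps lie.scale_right_distrib lie.scale_left_distrib mult.commute algebra_simps)

lemma fox_scale_half: "fox_scale (1 / 2) p + fox_scale (1 / 2) p = (p :: ('x, 'k::field_char_0) fox)"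
  by (simp flip: fox.scale_left_distrib)

global_interpretation model: initial_lie_dialgebra
  "model_scale :: 'k::field_char_0 \<Rightarrow> ('x, 'k) model \<Rightarrow> _" model_mult
proof -
  interpret nonassoc_algebra "model_scale :: 'k \<Rightarrow> ('x, 'k) model \<Rightarrow> _" model_mult
    by (rule nonassoc_algebra_model)
  show "initial_lie_dialgebra (model_scale :: 'k \<Rightarrow> ('x, 'k) model \<Rightarrow> _) model_mult"
  proof
    fix a b c :: "('x, 'k) model"
    obtain a1 a2 b1 b2 c1 c2 where abc: "a = (a1, a2)" "b = (b1, b2)" "c = (c1, c2)"
      by (cases a, cases b, cases c)
    \<comment> \<open>Writing one half as a polynomial \<open>h\<close> leaves a computation in a
      commutative ring in which the only relation needed is \<open>h + h = 1\<close>.\<close>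
    define h :: "('x, 'k) fox" where "h = Poly_Mapping.single 0 (1 / 2)"
    have "h + h = 1" by (simp add: h_def flip: single_add)
    have h: "h * h * p + h * h * p = h * p" for p
    proof -
      have "h * h * p + h * h * p = (h + h) * (h * p)" by (simp only: distrib_right mult.assoc)
      then show ?thesis by (simp only: \<open>h + h = 1\<close> mult_1_left)
    qed
    show "model_mult (model_mult a b) c = model_mult a (model_mult b c) - model_mult b (model_mult a c)"
    proof (rule prod_eqI)
      show "fst (model_mult (model_mult a b) c) = fst (model_mult a (model_mult b c) - model_mult b (model_mult a c))"
        by (simp add: model_mult_def lie_mult_leibniz lie.mult_simps lie.scale_right_diff_distrib)
      \<comment> \<open>The left side of the Leibniz identity contributes \<open>q / 4\<close> and
        the right side \<open>q / 2 - q / 4\<close>; the terms in \<open>c2\<close> cancel.\<close>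
      have "snd (model_mult (model_mult a b) c) - snd (model_mult a (model_mult b c) - model_mult b (model_mult a c))
         = (h * h * q + h * h * q) - h * q" if "q = lie_ab a1 * lie_fox b1 * lie_fox c1 - lie_ab b1 * lie_fox a1 * lie_fox c1" for q
        unfolding that
        by (simp add: abc model_mult_def lie_ab_simps lie_fox_simps fox_scale_def algebra_simps flip: h_def)
      then show "snd (model_mult (model_mult a b) c) = snd (model_mult a (model_mult b c) - model_mult b (model_mult a c))"
        by (simp add: h)
    qed
    show "model_mult a (model_mult b c) - model_mult a (model_mult c b) - model_mult b (model_mult a c)
      + model_mult b (model_mult c a) + model_mult c (model_mult a b) - model_mult c (model_mult b a) = 0" (is "?I = 0")
    proof (rule prod_eqI)
      let ?J = "lie_mult a1 (lie_mult b1 c1) + lie_mult b1 (lie_mult c1 a1) + lie_mult c1 (lie_mult a1 b1)"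
      \<comment> \<open>Antisymmetry pairs the six terms of \<open>initial\<close> into twice the
        Jacobi sum, with the factor 1/4 from the two nested halves.\<close>
      have "fst ?I = lie_scale (1 / 4) ?J + lie_scale (1 / 4) ?J"
        by (simp add: abc model_mult_def lie.mult_simps lie_mult_commute[of b1 a1] lie_mult_commute[of c1 b1]
            lie_mult_commute[of a1 c1] lie.scale_right_distrib algebra_simps)
      then show "fst ?I = fst 0"
        by (simp add: lie.jacobi)
      \<comment> \<open>Commutativity of the ring cancels the terms with two Fox derivatives, and
        those with a second component, in pairs.\<close>
      show "snd ?I = snd 0"
        by (simp add: abc model_mult_def lie_ab_simps lie_fox_simps fox_scale_def algebra_simps flip: h_def)
    qed
  qed
qed

lift_definition to_model :: "('x, 'k::field_char_0) free_dilie \<Rightarrow> ('x, 'k) model"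
  is "na_extend model_scale model_mult (\<lambda>x. (lie_gen x, 0))"
proof (erule model.ext_cong)
  fix s :: "('x, 'k) free_nonassoc"
  assume "s \<in> dilie_ids"
  then consider a b c where "s = (a \<odot> b) \<odot> c - (a \<odot> (b \<odot> c) - b \<odot> (a \<odot> c))"
    | a b c where "s = a \<odot> (b \<odot> c) - a \<odot> (c \<odot> b) - b \<odot> (a \<odot> c)
        + b \<odot> (c \<odot> a) + c \<odot> (a \<odot> b) - c \<odot> (b \<odot> a)"
    by (auto simp: dilie_ids_def)
  then show "na_extend model_scale model_mult (\<lambda>x. (lie_gen x, 0)) s = 0"
    by cases (simp_all only: model.ext_simps model.initial, simp add: model.leibniz)
qed

lemma to_model_gen: "to_model (dilie_gen x) = (lie_gen x, 0)"
  by transfer simp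

lemma to_model_add: "to_model (a + b) = to_model a + to_model b"
  by transfer (rule model.ext_add)

lemma to_model_diff: "to_model (a - b) = to_model a - to_model b"
  by transfer (rule model.ext_diff)

lemma to_model_scale: "to_model (dilie_scale c a) = model_scale c (to_model a)"
  by transfer (rule model.ext_scale)

lemma to_model_mult: "to_model (dilie_mult a b) = model_mult (to_model a) (to_model b)"
  by transfer (rule model.ext_mult)

lemma to_model_zero [simp]: "to_model 0 = 0"
  using to_model_diff[of 0 0] by simp

lemma to_model_comm: "to_model (dilie_comm a b) = commutator model_mult (to_model a) (to_model b)"
  by (simp add: commutator_def to_model_diff to_model_mult)

lemma to_model_acomm: "to_model (dilie_acomm a b) = anticommutator model_mult (to_model a) (to_model b)"
  by (simp add: anticommutator_def to_model_add to_model_mult)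

lemma linear_snd_to_model:
  "Vector_Spaces.linear dilie_scale fox_scale (\<lambda>a :: ('x, 'k::field_char_0) free_dilie. snd (to_model a))"
  by (simp add: Vector_Spaces.linear_iff dilie.vector_space_axioms vector_space_fox
      to_model_add to_model_scale model_scale_def)

lemma model_comm:
  "commutator model_mult (u, 0) (v, 0) = (lie_mult u v, 0 :: ('x, 'k::field_char_0) fox)"
proof -
  have "lie_scale (1 / 2) w + lie_scale (1 / 2) w = w" for w :: "('x, 'k) free_lie"
    by (simp flip: lie.scale_left_distrib)
  then show ?thesis
    by (simp add: commutator_def model_mult_def lie_mult_commute[of v u] mult.commute)
qed

text \<open>On Lie words this follows by induction from \<open>model_comm\<close>. It makes the
  first component of \<open>to_model\<close> a left inverse of \<open>lie_to_dilie\<close>.\<close>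

lemma to_model_lie: "to_model (lie_to_dilie u) = (u, 0)"
proof -
  have word: "to_model (lie_to_dilie (word_eval lie_mult lie_gen w)) = (word_eval lie_mult lie_gen w, 0)" for w
    by (induction w) (simp_all add: lie_to_dilie_gen to_model_gen lie_to_dilie_mult to_model_comm model_comm)
  have "u \<in> lie.span (range (word_eval lie_mult lie_gen))"
    by (simp add: span_lie_words)
  then show ?thesis
  proof (induction rule: lie.span_induct_alt)
    case base
    then show ?case by (simp add: lie_to_dilie.zero zero_prod_def)
  next
    case (step c w v)
    then show ?case
      by (auto simp: lie_to_dilie.add lie_to_dilie.scale to_model_add to_model_scale model_scale_def word)
  qed
qed

section \<open>Images of canonical words in the model\<close>

lemma model_acomm_gen:
  "anticommutator model_mult (lie_gen x, 0) (lie_gen y, 0)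
     = (0, Poly_Mapping.single ({#}, {#x, y#}) 1 :: ('x, 'k::field_char_0) fox)"
  using fox_scale_half[of "Poly_Mapping.single ({#}, {#x, y#}) 1 :: ('x, 'k) fox"]
  by (simp add: anticommutator_def model_mult_def lie_mult_commute[of "lie_gen y"] lie_fox_simps
      mult_single add_mset_commute)

text \<open>A pair with zero Lie component annihilates from the left. What remains is the action of
  the letter \<open>y\<close>, which multiplies by its abelianization.\<close>

lemma model_acomm_fox:
  "anticommutator model_mult (0, Poly_Mapping.single (T, D) 1) (lie_gen y, 0)
     = (0, Poly_Mapping.single (add_mset y T, D) 1 :: ('x, 'k::field_char_0) fox)"
proof -
  have "lie_ab 0 = (0 :: ('x, 'k) fox)" "lie_fox 0 = (0 :: ('x, 'k) fox)"
    using lie_ab_simps(3)[of "0 :: ('x, 'k) free_lie" 0] lie_fox_simps(3)[of "0 :: ('x, 'k) free_lie" 0]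
    by simp_all
  then show ?thesis
    by (simp add: anticommutator_def model_mult_def lie_ab_simps mult_single)
qed

text \<open>Exponents of the monomial that represents the word in the model.\<close>

definition word_monomial :: "'x list \<Rightarrow> 'x multiset \<times> 'x multiset" where
  "word_monomial xs = (mset (drop 2 xs), {#xs ! 0, xs ! 1#})"

lemma to_model_left_normed:
  assumes "xs \<in> canonical_words"
  shows "to_model (left_normed dilie_acomm dilie_gen xs)
    = (0, Poly_Mapping.single (word_monomial xs) 1 :: ('x::linorder, 'k::field_char_0) fox)"
proof -
  let ?g = "\<lambda>x. (lie_gen x, 0) :: ('x, 'k) model"
  have foldl: "foldl (anticommutator model_mult) (0, Poly_Mapping.single (T, D) 1) (map ?g ys)
      = (0, Poly_Mapping.single (mset ys + T, D) 1)" for T D ys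
    by (induction ys arbitrary: T) (simp_all add: model_acomm_fox)
  obtain x y ys where xs: "xs = x # y # ys"
    using assms by (elim canonical_wordsE)
  have "to_model (left_normed dilie_acomm dilie_gen xs) = left_normed (anticommutator model_mult) ?g xs"
    using left_normed_hom[where T = "to_model :: _ \<Rightarrow> ('x, 'k) model" and mult = dilie_acomm
        and mult' = "anticommutator model_mult" and g = dilie_gen and xs = xs]
    by (simp add: to_model_acomm to_model_gen)
  also have "\<dots> = (0, Poly_Mapping.single (word_monomial xs) 1)"
    by (simp add: xs left_normed_Cons2 model_acomm_gen foldl word_monomial_def)
  finally show ?thesis .
qed

text \<open>The ordering conditions on canonical words enter here: a sorted tail is determined by
  its multiset, and so is the ordered pair of the first two letters.\<close>

lemma inj_on_word_monomial: "inj_on word_monomial canonical_words"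
proof (rule inj_onI)
  fix xs ys :: "'a list"
  assume "xs \<in> canonical_words" "ys \<in> canonical_words" and eq: "word_monomial xs = word_monomial ys"
  then obtain x y zs x' y' zs' where xs: "xs = x # y # zs" "x \<le> y" "sorted zs"
      and ys: "ys = x' # y' # zs'" "x' \<le> y'" "sorted zs'"
    by (elim canonical_wordsE) blast
  have "zs = zs'"
    using eq xs ys by (metis Pair_inject drop_Suc_Cons drop0 numeral_2_eq_2 properties_for_sort word_monomial_def)
  moreover have "x = x' \<and> y = y'"
    using eq xs(2) ys(2) by (auto simp: word_monomial_def xs(1) ys(1) add_eq_conv_diff)
  ultimately show "xs = ys" by (simp add: xs ys)
qed

lemma snd_to_model_left_normed_inj:
  "inj_on (\<lambda>xs. snd (to_model (left_normed dilie_acomm dilie_gen xs)) :: ('x::linorder, 'k::field_char_0) fox)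
     canonical_words"
  using inj_on_word_monomial
  by (auto simp: inj_on_def to_model_left_normed dest!: injD[OF inj_fox_single])

lemma inj_on_left_normed_dilie:
  "inj_on (left_normed dilie_acomm (dilie_gen :: 'x::linorder \<Rightarrow> ('x, 'k::field_char_0) free_dilie)) canonical_words"
  using snd_to_model_left_normed_inj[where ?'k = 'k] by (auto simp: inj_on_def)

section \<open>Independence of canonical words, alone and together with Lie elements\<close>

text \<open>The second component of the model sends canonical words to distinct monomials.\<close>

lemma independent_left_normed_dilie:
  "dilie.independent (left_normed dilie_acomm (dilie_gen :: 'x::linorder \<Rightarrow> ('x, 'k::field_char_0) free_dilie) ` canonical_words)"
proof (rule vector_space_pair.independent_if_independent_image[OF _ linear_snd_to_model])
  show "vector_space_pair (dilie_scale :: 'k \<Rightarrow> ('x, 'k) free_dilie \<Rightarrow> _) fox_scale"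
    by (simp add: vector_space_pair_def dilie.vector_space_axioms vector_space_fox)
  show "fox.independent ((\<lambda>a. snd (to_model a)) `
      left_normed dilie_acomm (dilie_gen :: 'x \<Rightarrow> ('x, 'k) free_dilie) ` canonical_words)"
    by (rule fox.independent_mono[OF fox_independent_monomials]) (auto simp: to_model_left_normed)
  show "inj_on (\<lambda>a. snd (to_model a)) (left_normed dilie_acomm (dilie_gen :: 'x \<Rightarrow> ('x, 'k) free_dilie) ` canonical_words)"
    using snd_to_model_left_normed_inj by (auto simp: inj_on_def)
qed

lemma fst_to_model_span:
  fixes v :: "('x::linorder, 'k::field_char_0) free_dilie"
  assumes "v \<in> dilie_com_s.left_normed_span dilie_gen"
  shows "fst (to_model v) = 0"
  using assms
  by (induction rule: dilie.span_induct_alt)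
    (auto simp: to_model_add to_model_scale model_scale_def to_model_left_normed)

lemma inj_lie_to_dilie: "inj (lie_to_dilie :: ('x, 'k::field_char_0) free_lie \<Rightarrow> _)"
  by (rule injI) (metis to_model_lie fst_conv)

text \<open>The two spans meet in zero only: the first component of the model vanishes on canonical
  words and recovers a Lie element.\<close>

lemma independent_Un_lie:
  fixes L :: "('x::linorder, 'k::field_char_0) free_lie set"
  assumes "lie.independent L"
  shows "dilie.independent (left_normed dilie_acomm dilie_gen ` canonical_words \<union> lie_to_dilie ` L)"
proof (rule dilie.independent_Un_disjoint_span)
  show "dilie.independent (lie_to_dilie ` L)"
    using assms inj_lie_to_dilie by (rule lie_to_dilie.independent_inj_image)
  show "dilie_com_s.left_normed_span dilie_gen \<inter> dilie.span (lie_to_dilie ` L) \<subseteq> {0}"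
  proof clarify
    fix a assume a: "a \<in> dilie_com_s.left_normed_span dilie_gen" "a \<in> dilie.span (lie_to_dilie ` L)"
    then obtain u where "a = lie_to_dilie u" by (auto simp: lie_to_dilie.span_image)
    with fst_to_model_span[OF a(1)] show "a = 0" by (simp add: to_model_lie lie_to_dilie.zero)
  qed
qed (rule independent_left_normed_dilie)

lemma inj_lie_gen: "inj (lie_gen :: 'x \<Rightarrow> ('x, 'k::field) free_lie)"
proof (rule injI)
  fix x y :: 'x
  assume "(lie_gen x :: ('x, 'k) free_lie) = lie_gen y"
  then have "(lie_ab (lie_gen x) :: ('x, 'k) fox) = lie_ab (lie_gen y)" by simp
  then show "x = y" by (simp add: lie_ab_simps inj_eq[OF inj_fox_single])
qed

text \<open>The abelianization maps the generators to distinct variables.\<close>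

lemma independent_lie_gen: "lie.independent (range (lie_gen :: 'x \<Rightarrow> ('x, 'k::field) free_lie))"
proof (rule vector_space_pair.independent_if_independent_image[OF _ linear_lie_ab])
  show "vector_space_pair (lie_scale :: 'k \<Rightarrow> ('x, 'k) free_lie \<Rightarrow> _) fox_scale"
    by (simp add: vector_space_pair_def lie.vector_space_axioms vector_space_fox)
  show "fox.independent (lie_ab ` range (lie_gen :: 'x \<Rightarrow> ('x, 'k) free_lie))"
    by (rule fox.independent_mono[OF fox_independent_monomials]) (auto simp: lie_ab_simps)
  show "inj_on lie_ab (range (lie_gen :: 'x \<Rightarrow> ('x, 'k) free_lie))"
    by (auto simp: inj_on_def lie_ab_simps inj_eq[OF inj_fox_single])
qed

section \<open>Words of all degrees and the embedding of \<open>Com^S\<close>\<close>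

section \<open>The bases\<close>

text \<open>Indexes a basis of the whole of \<open>Com^S\<close>, in contrast to
  \<open>canonical_words\<close>, which indexes one of its square.\<close>

definition all_words :: "'x::linorder list set" where
  "all_words = canonical_words \<union> range (\<lambda>x. [x])"

lemma image_left_normed_all_words:
  "left_normed mult g ` all_words = range g \<union> left_normed mult g ` canonical_words"
  by (auto simp: all_words_def image_Un image_image)

lemma inj_on_left_normed_dilie_all:
  "inj_on (left_normed dilie_acomm (dilie_gen :: 'x::linorder \<Rightarrow> ('x, 'k::field_char_0) free_dilie)) all_words"
proof -
  \<comment> \<open>Letters have a nonzero Lie component in the model and canonical words a zero
    one, which keeps the two kinds apart.\<close>
  have "(lie_gen x :: ('x, 'k) free_lie) \<noteq> 0" for x
    using independent_lie_gen[where ?'x = 'x and ?'k = 'k] lie.dependent_zero by (metis rangeI)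
  then have "dilie_gen x \<noteq> left_normed dilie_acomm (dilie_gen :: 'x \<Rightarrow> ('x, 'k) free_dilie) xs"
    if "xs \<in> canonical_words" for x xs
    using arg_cong[where f = to_model] to_model_left_normed[OF that, where ?'k = 'k] to_model_gen[of x]
    by (metis fst_conv)
  moreover have "inj (dilie_gen :: 'x \<Rightarrow> ('x, 'k) free_dilie)"
    by (rule injI) (metis inj_lie_gen injD to_model_gen fst_conv)
  ultimately show ?thesis
    unfolding all_words_def inj_on_Un
    using inj_on_left_normed_dilie[where ?'x = 'x and ?'k = 'k]
    by (auto simp: inj_on_def; metis)
qed

lemma independent_left_normed_dilie_all:
  "dilie.independent (left_normed dilie_acomm (dilie_gen :: 'x::linorder \<Rightarrow> ('x, 'k::field_char_0) free_dilie) ` all_words)"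
proof -
  \<comment> \<open>The letters are images of Lie elements, so \<open>independent_Un_lie\<close>
    covers them with \<open>range lie_gen\<close> in the role of \<open>L\<close>.\<close>
  have "range (dilie_gen :: 'x \<Rightarrow> ('x, 'k) free_dilie) = lie_to_dilie ` range lie_gen"
    by (simp add: image_image lie_to_dilie_gen)
  then show ?thesis
    using independent_Un_lie[OF independent_lie_gen[where ?'x = 'x and ?'k = 'k]]
    by (simp add: image_left_normed_all_words Un_commute)
qed

lemma com_s_to_dilie_inj_on_all_words:
  "inj_on com_s_to_dilie (left_normed com_s_mult (com_s_gen :: 'x::linorder \<Rightarrow> ('x, 'k::field_char_0) free_com_s) ` all_words)"
  using inj_on_left_normed_dilie_all[where ?'x = 'x and ?'k = 'k]
  by (intro inj_on_imageI) (simp add: comp_def com_s_to_dilie_left_normed)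

text \<open>Independence is pulled back from the free dialgebra, so \<open>Com^S\<close> requires no
  model of its own.\<close>

lemma independent_left_normed_com_s:
  "com_s.independent (left_normed com_s_mult (com_s_gen :: 'x::linorder \<Rightarrow> ('x, 'k::field_char_0) free_com_s) ` all_words)"
proof (rule vector_space_pair.independent_if_independent_image[OF _ linear_com_s_to_dilie])
  show "vector_space_pair (com_s_scale :: 'k \<Rightarrow> ('x, 'k) free_com_s \<Rightarrow> _) dilie_scale"
    by (simp add: vector_space_pair_def com_s.vector_space_axioms dilie.vector_space_axioms)
  show "dilie.independent (com_s_to_dilie ` left_normed com_s_mult (com_s_gen :: 'x \<Rightarrow> ('x, 'k) free_com_s) ` all_words)"
    by (simp add: image_image com_s_to_dilie_left_normed independent_left_normed_dilie_all)
qed (rule com_s_to_dilie_inj_on_all_words)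

lemma inj_com_s_to_dilie: "inj (com_s_to_dilie :: ('x::linorder, 'k::field_char_0) free_com_s \<Rightarrow> _)"
proof -
  have "inj_on com_s_to_dilie (com_s.span (left_normed com_s_mult
      (com_s_gen :: 'x \<Rightarrow> ('x, 'k) free_com_s) ` all_words))"
    by (rule com_s_to_dilie.inj_on_span_independent_image)
      (simp_all add: image_image com_s_to_dilie_left_normed independent_left_normed_dilie_all
        com_s_to_dilie_inj_on_all_words)
  then show ?thesis
    by (simp add: image_left_normed_all_words span_com_s_left_normed)
qed

section \<open>Comparison of \<open>Com^S\<close> with its square\<close>

text \<open>\<open>Com\<^sup>S\<langle>X\<rangle>\<close> and its square have bases of the same cardinality: powers of a single generator
  are shifted up by one degree, and all other basis words stay fixed.\<close>

definition shift_power :: "'x list \<Rightarrow> 'x list" where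
  "shift_power xs = (if \<exists>x. set xs = {x} then hd xs # xs else xs)"

lemma bij_betw_shift_power: "bij_betw shift_power (all_words :: 'x::linorder list set) canonical_words"
proof (rule bij_betw_imageI)
  have ne: "xs \<noteq> []" if "xs \<in> all_words" for xs :: "'x list"
    using that by (auto simp: all_words_def canonical_words_def)
  \<comment> \<open>Since the set of letters is preserved, the image reveals which case of
    \<open>shift_power\<close> was applied.\<close>
  have set: "set (shift_power xs) = set xs" if "xs \<noteq> []" for xs :: "'x list"
    using that by (simp add: shift_power_def insert_absorb)
  show "inj_on shift_power (all_words :: 'x list set)"
  proof (rule inj_onI)
    fix xs ys :: "'x list"
    assume "xs \<in> all_words" "ys \<in> all_words" and eq: "shift_power xs = shift_power ys"
    then have "set xs = set ys"
      using set[OF ne, of xs] set[OF ne, of ys] by simp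
    then show "xs = ys"
      using eq by (cases "\<exists>x. set ys = {x}") (simp_all add: shift_power_def)
  qed
  have sorted: "sorted zs" if "set zs \<subseteq> {x}" for x :: 'x and zs
    using that by (induction zs) auto
  show "shift_power ` all_words = (canonical_words :: 'x list set)"
  proof (intro equalityI subsetI)
    fix ys :: "'x list"
    assume "ys \<in> shift_power ` all_words"
    then obtain xs where xs: "xs \<in> all_words" "ys = shift_power xs" by blast
    show "ys \<in> canonical_words"
    proof (cases "\<exists>x. set xs = {x}")
      case True
      then obtain x zs where "xs = x # zs" "set xs = {x}"
        using ne[OF xs(1)] by (cases xs) auto
      then show ?thesis
        using sorted[of zs x] True by (auto simp: xs(2) shift_power_def canonical_words_Cons2)
    next
      case False
      then show ?thesis using xs by (auto simp: shift_power_def all_words_def)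
    qed
  next
    fix ys :: "'x list"
    assume ys: "ys \<in> canonical_words"
    show "ys \<in> shift_power ` all_words"
    proof (cases "\<exists>x. set ys = {x}")
      case True
      then obtain x y zs where zs: "ys = x # y # zs" "set ys = {x}"
        using ys by (elim canonical_wordsE) auto
      then have y: "y = x" "set zs \<subseteq> {x}" by auto
      \<comment> \<open>The preimage drops one copy of \<open>x\<close>; for a square of a generator
        this leaves the single letter.\<close>
      have "x # zs \<in> all_words"
      proof (cases zs)
        case Nil
        then show ?thesis by (simp add: all_words_def)
      next
        case (Cons z zs')
        then show ?thesis
          using y sorted[of zs' x] by (simp add: all_words_def canonical_words_Cons2)
      qed
      moreover have "shift_power (x # zs) = ys"
        using zs y by (auto simp: shift_power_def)
      ultimately show ?thesis by blast
    next
      case False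
      then have "shift_power ys = ys" by (simp add: shift_power_def)
      then show ?thesis using ys by (force simp: all_words_def)
    qed
  qed
qed

text \<open>The image of \<open>com_s_to_dilie\<close> shares the generators with the Lie part, so a
  direct sum with the whole of \<open>Com^S\<close> needs a different linear map. It is obtained by
  transporting \<open>shift_power\<close> to bases.\<close>

lemma com_s_iso_square:
  obtains \<phi> :: "('x::linorder, 'k::field_char_0) free_com_s \<Rightarrow> ('x, 'k) free_dilie"
  where "Vector_Spaces.linear com_s_scale dilie_scale \<phi>" "inj \<phi>"
    "range \<phi> = dilie_com_s.left_normed_span dilie_gen"
proof -
  interpret vector_space_pair "com_s_scale :: 'k \<Rightarrow> ('x, 'k) free_com_s \<Rightarrow> _"
    "dilie_scale :: 'k \<Rightarrow> ('x, 'k) free_dilie \<Rightarrow> _"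
    by (simp add: vector_space_pair_def com_s.vector_space_axioms dilie.vector_space_axioms)
  let ?c = "left_normed com_s_mult (com_s_gen :: 'x \<Rightarrow> ('x, 'k) free_com_s)"
  let ?d = "left_normed dilie_acomm (dilie_gen :: 'x \<Rightarrow> ('x, 'k) free_dilie)"
  have inj_c: "inj_on ?c all_words"
    using inj_on_left_normed_dilie_all[where ?'x = 'x and ?'k = 'k]
    by (intro inj_on_imageI2[of com_s_to_dilie ?c]) (simp add: comp_def com_s_to_dilie_left_normed)
  \<comment> \<open>By \<open>inj_c\<close>, \<open>inv_into\<close> recovers the index word of a
    basis element.\<close>
  obtain \<phi> where lin: "Vector_Spaces.linear com_s_scale dilie_scale \<phi>"
    and "\<forall>b\<in>?c ` all_words. \<phi> b = ?d (shift_power (inv_into all_words ?c b))"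
    using linear_independent_extend[OF independent_left_normed_com_s,
        of "\<lambda>b. ?d (shift_power (inv_into all_words ?c b))"] by blast
  then have \<phi>: "\<phi> (?c xs) = ?d (shift_power xs)" if "xs \<in> all_words" for xs
    using that inj_c by simp
  interpret \<phi>: Vector_Spaces.linear com_s_scale dilie_scale \<phi> by (rule lin)
  have span: "com_s.span (?c ` all_words) = UNIV"
    by (simp add: image_left_normed_all_words span_com_s_left_normed)
  have img: "\<phi> ` ?c ` all_words = ?d ` canonical_words"
    using bij_betw_imp_surj_on[OF bij_betw_shift_power[where ?'x = 'x]] \<phi>
    by (metis (no_types, lifting) image_cong image_image)
  have "inj_on (\<lambda>xs. ?d (shift_power xs)) all_words"
    using comp_inj_on[of shift_power all_words ?d] bij_betw_shift_power[where ?'x = 'x]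
      inj_on_left_normed_dilie[where ?'x = 'x and ?'k = 'k]
    by (simp add: bij_betw_def comp_def)
  then have "inj_on \<phi> (?c ` all_words)"
    by (intro inj_on_imageI) (simp add: comp_def \<phi> cong: inj_on_cong)
  moreover have "dilie.independent (\<phi> ` ?c ` all_words)"
    unfolding img by (rule independent_left_normed_dilie)
  ultimately have "inj_on \<phi> (com_s.span (?c ` all_words))"
    by (intro \<phi>.inj_on_span_independent_image)
  then have "inj \<phi>"
    by (simp only: span)
  moreover have "range \<phi> = dilie.span (?d ` canonical_words)"
    using \<phi>.span_image[of "?c ` all_words"] by (simp only: img span)
  ultimately show thesis using that lin by blast
qed

section \<open>Direct sum decompositions\<close>

text \<open>The first component of the model projects such a sum onto its Lie part; cancellation
  then gives the other part.\<close>

lemma lie_add_square_eq_iff: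
  fixes v v' :: "('x::linorder, 'k::field_char_0) free_dilie"
  assumes "v \<in> dilie_com_s.left_normed_span dilie_gen" "v' \<in> dilie_com_s.left_normed_span dilie_gen"
  shows "lie_to_dilie u + v = lie_to_dilie u' + v' \<longleftrightarrow> u = u' \<and> v = v'"
proof
  assume eq: "lie_to_dilie u + v = lie_to_dilie u' + v'"
  have "fst (to_model (lie_to_dilie u + v)) = u" "fst (to_model (lie_to_dilie u' + v')) = u'"
    using assms by (simp_all add: to_model_add to_model_lie fst_to_model_span)
  with eq show "u = u' \<and> v = v'" by simp
qed simp

lemma vector_space_sum_scale:
  "vector_space (sum_scale :: 'k::field \<Rightarrow> ('x, 'k) free_lie \<times> ('x, 'k) free_com_s \<Rightarrow> _)"
  by standard
    (auto simp: sum_scale_def prod_eq_iff lie.scale_right_distrib lie.scale_left_distrib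
      com_s.scale_right_distrib com_s.scale_left_distrib)

lemma dilie_linear_iso_sum:
  "\<exists>f :: ('x::linorder, 'k::field_char_0) free_lie \<times> ('x, 'k) free_com_s \<Rightarrow> ('x, 'k) free_dilie.
     Vector_Spaces.linear sum_scale dilie_scale f \<and> bij f \<and> (\<forall>u. f (u, 0) = lie_to_dilie u)"
proof -
  obtain \<phi> :: "('x, 'k) free_com_s \<Rightarrow> ('x, 'k) free_dilie"
    where lin: "Vector_Spaces.linear com_s_scale dilie_scale \<phi>" and "inj \<phi>"
      and range: "range \<phi> = dilie_com_s.left_normed_span dilie_gen"
    by (rule com_s_iso_square)
  interpret \<phi>: Vector_Spaces.linear com_s_scale dilie_scale \<phi> by (rule lin)
  define f where "f p = lie_to_dilie (fst p) + \<phi> (snd p)" for p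
  have "Vector_Spaces.linear sum_scale dilie_scale f"
    by (simp add: Vector_Spaces.linear_iff vector_space_sum_scale dilie.vector_space_axioms f_def
        sum_scale_def lie_to_dilie.add lie_to_dilie.scale \<phi>.add \<phi>.scale dilie.scale_right_distrib)
  moreover have "inj f"
  proof (rule injI)
    fix p q
    assume "f p = f q"
    moreover have "\<phi> (snd p) \<in> range \<phi>" "\<phi> (snd q) \<in> range \<phi>" by auto
    ultimately have "fst p = fst q \<and> \<phi> (snd p) = \<phi> (snd q)"
      unfolding f_def range by (simp add: lie_add_square_eq_iff)
    then show "p = q" using \<open>inj \<phi>\<close> by (simp add: prod_eq_iff inj_eq)
  qed
  moreover have "surj f"
  proof -
    have "a \<in> range f" for a
    proof -
      obtain u v where "v \<in> dilie_com_s.left_normed_span dilie_gen" "a = lie_to_dilie u + v"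
        by (rule dilie_decompose)
      then obtain w where "a = f (u, w)"
        unfolding range[symmetric] by (auto simp: f_def)
      then show ?thesis by blast
    qed
    then show ?thesis by blast
  qed
  moreover have "f (u, 0) = lie_to_dilie u" for u
    by (simp add: f_def \<phi>.zero)
  ultimately show ?thesis unfolding bij_def by blast
qed

text \<open>Here the natural map from \<open>Com^S\<close> is kept. Restricting it to the square
  assigns the generators to the Lie part alone.\<close>

lemma dilie_unique_decomposition:
  fixes a :: "('x::linorder, 'k::field_char_0) free_dilie"
  shows "\<exists>!(u, v). v \<in> com_s_square \<and> a = lie_to_dilie u + com_s_to_dilie v"
proof -
  obtain u v where "v \<in> dilie_com_s.left_normed_span dilie_gen" "a = lie_to_dilie u + v"
    by (rule dilie_decompose)
  then obtain w where w: "w \<in> com_s_square" "a = lie_to_dilie u + com_s_to_dilie w"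
    unfolding com_s_to_dilie_square[symmetric] by blast
  have in_span: "com_s_to_dilie v \<in> dilie_com_s.left_normed_span dilie_gen"
    if "v \<in> com_s_square" for v :: "('x, 'k) free_com_s"
    using that com_s_to_dilie_square by blast
  show ?thesis
  proof (rule ex1I[of _ "(u, w)"])
    fix p :: "('x, 'k) free_lie \<times> ('x, 'k) free_com_s"
    assume "case p of (u, v) \<Rightarrow> v \<in> com_s_square \<and> a = lie_to_dilie u + com_s_to_dilie v"
    then show "p = (u, w)"
      using w in_span
      by (auto simp: lie_add_square_eq_iff dest: injD[OF inj_com_s_to_dilie] split: prod.splits)
  qed (use w in simp)
qed

lemma is_basis_canonical_Un_lie:
  fixes L :: "('x::linorder, 'k::field_char_0) free_lie set"
  assumes "is_basis lie_scale L"
  shows "is_basis dilie_scale ((\<Union>n\<in>{2..}. C_S n) \<union> lie_to_dilie ` L)"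
  unfolding is_basis_def Un_C_S_2
proof
  let ?B = "left_normed dilie_acomm dilie_gen ` canonical_words \<union> lie_to_dilie ` L"
  show "dilie.independent ?B"
    using assms by (simp add: is_basis_def independent_Un_lie)
  have "a \<in> dilie.span ?B" for a
  proof -
    obtain u v where v: "v \<in> dilie_com_s.left_normed_span dilie_gen" and a: "a = lie_to_dilie u + v"
      by (rule dilie_decompose)
    have "lie_to_dilie u \<in> dilie.span (lie_to_dilie ` L)"
      using assms by (simp add: is_basis_def lie_to_dilie.span_image)
    then show ?thesis
      unfolding a by (intro dilie.span_add)
        (rule subsetD[OF dilie.span_mono[OF Un_upper2]] subsetD[OF dilie.span_mono[OF Un_upper1] v], assumption?)+
  qed
  then show "dilie.span ?B = UNIV" by blast
qed

text \<open>The set \<open>C_S 1\<close> consists of the generators. When \<open>L\<close> contains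
  them they are already present in the union; for an arbitrary basis \<open>L\<close> the words
  start at degree two. The direct sum appears both as an abstract linear isomorphism with the full
  \<open>Com^S\<close> and as a decomposition along the natural maps.\<close>

theorem theorem4p3:
  fixes L :: "('x::linorder, 'k::field_char_0) free_lie set"
  assumes "is_basis lie_scale L"
  shows "(range lie_gen \<subseteq> L \<longrightarrow>
           is_basis dilie_scale ((\<Union>n\<in>{1..}. C_S n) \<union> lie_to_dilie ` L))
    \<and> is_basis dilie_scale ((\<Union>n\<in>{2..}. C_S n) \<union> lie_to_dilie ` L)
    \<and> (\<exists>f :: ('x, 'k) free_lie \<times> ('x, 'k) free_com_s \<Rightarrow> ('x, 'k) free_dilie.
         Vector_Spaces.linear sum_scale dilie_scale f \<and> bij f \<and>
         (\<forall>u. f (u, 0) = lie_to_dilie u))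
    \<and> inj (lie_to_dilie :: ('x, 'k) free_lie \<Rightarrow> ('x, 'k) free_dilie)
    \<and> inj (com_s_to_dilie :: ('x, 'k) free_com_s \<Rightarrow> ('x, 'k) free_dilie)
    \<and> (\<forall>a :: ('x, 'k) free_dilie.
         \<exists>!(u, v). v \<in> com_s_square \<and> a = lie_to_dilie u + com_s_to_dilie v)"
proof (intro conjI impI allI)
  show basis: "is_basis dilie_scale ((\<Union>n\<in>{2..}. C_S n) \<union> lie_to_dilie ` L)"
    using assms by (rule is_basis_canonical_Un_lie)
  show "is_basis dilie_scale ((\<Union>n\<in>{1..}. C_S n) \<union> lie_to_dilie ` L)"
    if "range lie_gen \<subseteq> L"
  proof -
    have "range dilie_gen \<subseteq> lie_to_dilie ` L"
      using that by (auto simp flip: lie_to_dilie_gen)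
    then have "(\<Union>n\<in>{1..}. C_S n) \<union> lie_to_dilie ` L = (\<Union>n\<in>{2..}. C_S n) \<union> lie_to_dilie ` L"
      unfolding Un_C_S_1 by blast
    with basis show ?thesis by simp
  qed
qed (rule dilie_linear_iso_sum inj_lie_to_dilie inj_com_s_to_dilie dilie_unique_decomposition)+

end
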